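(* Let $A$ be a C$^*$-algebra and let $T: A\to A^{**}$ be a bounded linear operator. Then the following statements are equivalent: (a) $T$ is anti-derivable at zero, i.e. for all $a,b\in A$, $ab=0$ implies $T(b)a+bT(a)=0$; (b) There exists $\xi\in A^{**}$ satisfying $\xi a=a\xi$, $\xi[a,b]=0$, and $T(a)=\xi a$, for all $a,b\in A$.
   Context: C$^*$-algebras are complex and need not be unital. $A^{**}$ is the bidual of $A$ with its product as the enveloping von Neumann algebra (the unique Arens extension of the product of $A$), and $A$ is identified with its canonical image in $A^{**}$, so that $A^{**}$ is a Banach $A$-bimodule under multiplication. The commutator is $[a,b]=ab-ba$. *)

theory Defs
  imports "HOL-Analysis.Analysis"
begin

section \<open>Complex normed spaces and C*-algebras\<close>

class complex_normed_vector = real_normed_vector +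
  fixes scaleC :: "complex \<Rightarrow> 'a \<Rightarrow> 'a" (infixr \<open>*\<^sub>C\<close> 75)
  assumes scaleC_add_right: "c *\<^sub>C (x + y) = c *\<^sub>C x + c *\<^sub>C y"
    and scaleC_add_left: "(c + d) *\<^sub>C x = c *\<^sub>C x + d *\<^sub>C x"
    and scaleC_scaleC: "c *\<^sub>C d *\<^sub>C x = (c * d) *\<^sub>C x"
    and scaleR_scaleC: "r *\<^sub>R x = complex_of_real r *\<^sub>C x"
    and norm_scaleC: "norm (c *\<^sub>C x) = cmod c * norm x"

instantiation complex :: complex_normed_vector
begin

definition scaleC_complex :: "complex \<Rightarrow> complex \<Rightarrow> complex"
  where "scaleC_complex c x = c * x"

instance
  by standard (auto simp: scaleC_complex_def algebra_simps norm_mult scaleR_conv_of_real)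

end

text \<open>The algebra is not required to have a unit, and the zero algebra is allowed.\<close>

class cstar_algebra = complex_normed_vector + real_normed_algebra + complete_space +
  fixes star :: "'a \<Rightarrow> 'a"
  assumes mult_scaleC_left: "(c *\<^sub>C x) * y = c *\<^sub>C (x * y)"
    and mult_scaleC_right: "x * (c *\<^sub>C y) = c *\<^sub>C (x * y)"
    and star_add: "star (x + y) = star x + star y"
    and star_scaleC: "star (c *\<^sub>C x) = cnj c *\<^sub>C star x"
    and star_mult: "star (x * y) = star y * star x"
    and star_star: "star (star x) = x"
    and cstar_identity: "norm (star x * x) = (norm x)\<^sup>2"

instantiation complex :: cstar_algebra
begin

definition star_complex :: "complex \<Rightarrow> complex"
  where "star_complex = cnj"

instance
  by standard (auto simp: scaleC_complex_def star_complex_def norm_mult power2_eq_square)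

end

locale bounded_clinear = bounded_linear f
  for f :: "'a::complex_normed_vector \<Rightarrow> 'b::complex_normed_vector" +
  assumes scaleC: "f (c *\<^sub>C x) = c *\<^sub>C f x"

lemma bounded_clinearI:
  assumes "bounded_linear f" "\<And>c x. f (c *\<^sub>C x) = c *\<^sub>C f x"
  shows "bounded_clinear f"
  using assms by (simp add: bounded_clinear_def bounded_clinear_axioms_def)

lemma bounded_clinear_iff:
  "bounded_clinear f \<longleftrightarrow> bounded_linear f \<and> (\<forall>c x. f (c *\<^sub>C x) = c *\<^sub>C f x)"
  by (auto simp: bounded_clinear_def bounded_clinear_axioms_def)


section \<open>The dual of a complex normed space\<close>

typedef (overloaded) 'a cdual = "{f :: 'a::complex_normed_vector \<Rightarrow> complex. bounded_clinear f}"
  morphisms cdual_apply Cdual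
proof
  show "(\<lambda>x. 0) \<in> {f :: 'a \<Rightarrow> complex. bounded_clinear f}"
    by (simp add: bounded_clinear_iff scaleC_complex_def)
qed

setup_lifting type_definition_cdual

instantiation cdual :: (complex_normed_vector) complex_normed_vector
begin

lift_definition norm_cdual :: "'a cdual \<Rightarrow> real" is onorm .

lift_definition zero_cdual :: "'a cdual" is "\<lambda>x. 0"
  by (simp add: bounded_clinear_iff scaleC_complex_def)

lift_definition plus_cdual :: "'a cdual \<Rightarrow> 'a cdual \<Rightarrow> 'a cdual" is "\<lambda>f g x. f x + g x"
  by (simp add: bounded_clinear_iff bounded_linear_add scaleC_add_right)

lift_definition minus_cdual :: "'a cdual \<Rightarrow> 'a cdual \<Rightarrow> 'a cdual" is "\<lambda>f g x. f x - g x"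
  by (simp add: bounded_clinear_iff bounded_linear_sub scaleC_complex_def algebra_simps)

lift_definition uminus_cdual :: "'a cdual \<Rightarrow> 'a cdual" is "\<lambda>f x. - f x"
  by (simp add: bounded_clinear_iff bounded_linear_minus scaleC_complex_def)

lift_definition scaleR_cdual :: "real \<Rightarrow> 'a cdual \<Rightarrow> 'a cdual" is "\<lambda>r f x. r *\<^sub>R f x"
  by (simp add: bounded_clinear_iff scaleC_complex_def
      bounded_linear_compose[OF bounded_linear_scaleR_right])

lift_definition scaleC_cdual :: "complex \<Rightarrow> 'a cdual \<Rightarrow> 'a cdual" is "\<lambda>c f x. c * f x"
  by (simp add: bounded_clinear_iff scaleC_complex_def
      bounded_linear_compose[OF bounded_linear_mult_right])

definition dist_cdual :: "'a cdual \<Rightarrow> 'a cdual \<Rightarrow> real"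
  where "dist_cdual f g = norm (f - g)"

definition uniformity_cdual :: "('a cdual \<times> 'a cdual) filter"
  where "uniformity_cdual = (INF e\<in>{0 <..}. principal {(x, y). dist x y < e})"

definition open_cdual :: "'a cdual set \<Rightarrow> bool"
  where "open_cdual S = (\<forall>x\<in>S. \<forall>\<^sub>F (x', y) in uniformity. x' = x \<longrightarrow> y \<in> S)"

definition sgn_cdual :: "'a cdual \<Rightarrow> 'a cdual"
  where "sgn_cdual f = inverse (norm f) *\<^sub>R f"

lemma onorm_scaleC:
  fixes f :: "'a \<Rightarrow> complex"
  assumes f: "bounded_linear f"
  shows "onorm (\<lambda>x. c * f x) = cmod c * onorm f"
proof -
  have *: "onorm (\<lambda>x. d * g x) \<le> cmod d * onorm g" if "bounded_linear g" for d and g :: "'a \<Rightarrow> complex"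
    using that
    by (intro onorm_bound)
      (auto simp: norm_mult mult.assoc onorm_pos_le intro!: mult_left_mono onorm)
  show ?thesis
  proof (cases "c = 0")
    case False
    have "onorm f = onorm (\<lambda>x. inverse c * (c * f x))"
      using False by (simp add: mult.assoc[symmetric])
    also have "\<dots> \<le> cmod (inverse c) * onorm (\<lambda>x. c * f x)"
      by (intro * bounded_linear_compose[OF bounded_linear_mult_right f])
    finally have "cmod c * onorm f \<le> onorm (\<lambda>x. c * f x)"
      using False by (simp add: norm_divide field_simps)
    with *[OF f, of c] show ?thesis by linarith
  qed (simp add: onorm_zero)
qed

instance
  apply standard
  unfolding dist_cdual_def open_cdual_def sgn_cdual_def uniformity_cdual_def
  by (rule refl |
      (transfer, simp add: bounded_clinear_iff onorm_scaleC scaleR_conv_of_real; fail) |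
      (transfer, force simp: bounded_clinear_iff onorm_triangle onorm_scaleR
        onorm_eq_0 algebra_simps))+

end

lemma cdual_eqI: "(\<And>x. cdual_apply f x = cdual_apply g x) \<Longrightarrow> f = g"
  by transfer auto

lemma bounded_clinear_cdual_apply: "bounded_clinear (cdual_apply f)"
  using cdual_apply[of f] by simp

lemma bounded_linear_cdual_apply: "bounded_linear (cdual_apply f)"
  using bounded_clinear_cdual_apply bounded_clinear_iff by blast

lemma cdual_apply_scaleC: "cdual_apply f (c *\<^sub>C x) = c * cdual_apply f x"
  using bounded_clinear_cdual_apply[of f] by (simp add: bounded_clinear_iff scaleC_complex_def)

lemmas cdual_apply_add = linear_add[OF bounded_linear.linear[OF bounded_linear_cdual_apply]]
lemmas cdual_apply_scaleR = linear_scale[OF bounded_linear.linear[OF bounded_linear_cdual_apply]]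

lemma norm_cdual_apply: "cmod (cdual_apply f x) \<le> norm f * norm x"
  unfolding norm_cdual_def map_fun_def comp_def id_def
  by (rule onorm[OF bounded_linear_cdual_apply])

lemma norm_cdual_bound:
  "0 \<le> b \<Longrightarrow> (\<And>x. cmod (cdual_apply f x) \<le> b * norm x) \<Longrightarrow> norm f \<le> b"
  by transfer (rule onorm_bound)

lemma bounded_clinear_intro:
  fixes f :: "'a::complex_normed_vector \<Rightarrow> 'b::complex_normed_vector"
  assumes "\<And>x y. f (x + y) = f x + f y" "\<And>c x. f (c *\<^sub>C x) = c *\<^sub>C f x"
    and "\<And>x. norm (f x) \<le> norm x * K"
  shows "bounded_clinear f"
  using assms by (intro bounded_clinearI bounded_linear_intro[where K = K]) (auto simp: scaleR_scaleC)


section \<open>The bidual with the Arens product\<close>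

type_synonym 'a bidual = "'a cdual cdual"

lift_definition bidual_embed :: "'a::complex_normed_vector \<Rightarrow> 'a bidual"
  is "\<lambda>a f. cdual_apply f a"
proof (rule bounded_clinear_intro)
  show "cmod (cdual_apply f a) \<le> norm f * norm a" for a :: 'a and f
    by (rule norm_cdual_apply)
qed (simp_all add: plus_cdual.rep_eq scaleC_cdual.rep_eq scaleC_complex_def)

text \<open>
  The product on the bidual is the first Arens product, built in three steps:
  \<open>(f \<cdot> a) x = f (a x)\<close>, \<open>(\<Psi> \<cdot> f) a = \<Psi> (f \<cdot> a)\<close> and \<open>(\<Phi> \<Psi>) f = \<Phi> (\<Psi> \<cdot> f)\<close>. A C*-algebra is Arens
  regular, so this is the only Arens product. If one of the factors lies in the algebra, then the
  two Arens products coincide by definition: both are given by the formulas in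
  \<open>arens_mult_embed_right\<close> and \<open>arens_mult_embed_left\<close> below.
\<close>

lift_definition cdual_translate :: "'a::cstar_algebra cdual \<Rightarrow> 'a \<Rightarrow> 'a cdual"
  is "\<lambda>f a x. f (a * x)"
  by (simp add: bounded_clinear_iff mult_scaleC_right
      bounded_linear_compose[OF _ bounded_linear_mult_right])

lemma norm_cdual_translate: "norm (cdual_translate f a) \<le> norm f * norm a"
proof (rule norm_cdual_bound)
  fix x
  have "cmod (cdual_apply f (a * x)) \<le> norm f * norm (a * x)"
    by (rule norm_cdual_apply)
  also have "\<dots> \<le> norm f * (norm a * norm x)"
    by (intro mult_left_mono norm_mult_ineq norm_ge_zero)
  finally show "cmod (cdual_apply (cdual_translate f a) x) \<le> norm f * norm a * norm x"
    by (simp add: cdual_translate.rep_eq mult.assoc)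
qed simp

lemma cdual_translate_simps:
  "cdual_translate f (a + b) = cdual_translate f a + cdual_translate f b"
  "cdual_translate f (c *\<^sub>C a) = c *\<^sub>C cdual_translate f a"
  "cdual_translate (f + g) a = cdual_translate f a + cdual_translate g a"
  "cdual_translate (c *\<^sub>C f) a = c *\<^sub>C cdual_translate f a"
  by (rule cdual_eqI; simp add: cdual_translate.rep_eq plus_cdual.rep_eq scaleC_cdual.rep_eq
      distrib_right mult_scaleC_left cdual_apply_add cdual_apply_scaleC)+

lemma norm_bidual_translate:
  "cmod (cdual_apply \<Psi> (cdual_translate f a)) \<le> norm \<Psi> * norm f * norm a"
proof -
  have "cmod (cdual_apply \<Psi> (cdual_translate f a)) \<le> norm \<Psi> * norm (cdual_translate f a)"
    by (rule norm_cdual_apply)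
  also have "\<dots> \<le> norm \<Psi> * (norm f * norm a)"
    by (intro mult_left_mono norm_cdual_translate norm_ge_zero)
  finally show ?thesis by (simp add: mult.assoc)
qed

lift_definition bidual_act :: "'a::cstar_algebra bidual \<Rightarrow> 'a cdual \<Rightarrow> 'a cdual"
  is "\<lambda>\<Psi> f a. cdual_apply \<Psi> (cdual_translate f a)"
proof (rule bounded_clinear_intro)
  show "cmod (cdual_apply \<Psi> (cdual_translate f a)) \<le> norm a * (norm \<Psi> * norm f)"
    for \<Psi> :: "'a bidual" and f a
    using norm_bidual_translate[of \<Psi> f a] by (simp add: mult_ac)
qed (simp_all add: cdual_translate_simps cdual_apply_add cdual_apply_scaleC scaleC_complex_def)

lemma bidual_act_simps:
  "bidual_act \<Psi> (f + g) = bidual_act \<Psi> f + bidual_act \<Psi> g"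
  "bidual_act \<Psi> (c *\<^sub>C f) = c *\<^sub>C bidual_act \<Psi> f"
  by (rule cdual_eqI; simp add: bidual_act.rep_eq plus_cdual.rep_eq scaleC_cdual.rep_eq
      cdual_translate_simps cdual_apply_add cdual_apply_scaleC)+

lemma norm_bidual_act: "norm (bidual_act \<Psi> f) \<le> norm \<Psi> * norm f"
  by (rule norm_cdual_bound) (simp_all add: bidual_act.rep_eq norm_bidual_translate)

lift_definition arens_mult :: "'a::cstar_algebra bidual \<Rightarrow> 'a bidual \<Rightarrow> 'a bidual"
    (infixl \<open>\<star>\<close> 70)
  is "\<lambda>\<Phi> \<Psi> f. cdual_apply \<Phi> (bidual_act \<Psi> f)"
proof (rule bounded_clinear_intro)
  fix \<Phi> \<Psi> :: "'a bidual" and f :: "'a cdual"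
  have "cmod (cdual_apply \<Phi> (bidual_act \<Psi> f)) \<le> norm \<Phi> * norm (bidual_act \<Psi> f)"
    by (rule norm_cdual_apply)
  also have "\<dots> \<le> norm \<Phi> * (norm \<Psi> * norm f)"
    by (intro mult_left_mono norm_bidual_act norm_ge_zero)
  finally show "cmod (cdual_apply \<Phi> (bidual_act \<Psi> f)) \<le> norm f * (norm \<Phi> * norm \<Psi>)"
    by (simp add: mult_ac)
qed (simp_all add: bidual_act_simps cdual_apply_add cdual_apply_scaleC scaleC_complex_def)

lemma arens_mult_embed_right:
  "cdual_apply (\<Phi> \<star> bidual_embed a) f = cdual_apply \<Phi> (Cdual (\<lambda>x. cdual_apply f (x * a)))"
proof -
  have "cdual_apply (bidual_act (bidual_embed a) f) = (\<lambda>x. cdual_apply f (x * a))"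
    by (auto simp: bidual_act.rep_eq bidual_embed.rep_eq cdual_translate.rep_eq)
  then show ?thesis
    by (metis arens_mult.rep_eq cdual_apply_inverse)
qed

lemma arens_mult_embed_left:
  "cdual_apply (bidual_embed a \<star> \<Phi>) f = cdual_apply \<Phi> (Cdual (\<lambda>x. cdual_apply f (a * x)))"
  by (metis (no_types, lifting) ext arens_mult.rep_eq bidual_act.rep_eq bidual_embed.rep_eq
      cdual_apply_inverse cdual_translate.rep_eq)

lemma bidual_embed_mult: "bidual_embed (a * b) = bidual_embed a \<star> bidual_embed b"
  by (rule cdual_eqI)
    (simp add: arens_mult.rep_eq bidual_act.rep_eq bidual_embed.rep_eq cdual_translate.rep_eq)

definition anti_derivable_at_zero :: "('a::cstar_algebra \<Rightarrow> 'a bidual) \<Rightarrow> bool"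
  where "anti_derivable_at_zero T \<longleftrightarrow>
    (\<forall>a b. a * b = 0 \<longrightarrow> T b \<star> bidual_embed a + bidual_embed b \<star> T a = 0)"

definition commutator :: "'a::ring \<Rightarrow> 'a \<Rightarrow> 'a"
  where "commutator a b = a * b - b * a"

end

theory Submission
  imports
    Defs
    "HOL-Computational_Algebra.Polynomial"
    "HOL-Complex_Analysis.Cauchy_Integral_Formula"
begin

text \<open>
  The implication from the central multiplier \<open>\<xi>\<close> to anti-derivability is immediate: if \<open>ab = 0\<close>,
  then \<open>\<xi>ba + b\<xi>a = 2\<xi>ba = 2\<xi>ab = 0\<close>. The converse rests on the fact that a C*-algebra has so
  many zero products that a bounded bilinear map \<open>\<phi>\<close> that vanishes on them is balanced:
  \<open>\<phi>(ab, c) = \<phi>(a, bc)\<close> (theorem \<open>balanced\<close>).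

  To prove this, let \<open>h\<close> be self-adjoint and small, and put \<open>s = 2h / (1 + h\<^sup>2)\<close>. The Cayley
  transform of \<open>h\<close> is an isometry with imaginary part \<open>s\<close>, and this gives \<open>s\<close> a functional
  calculus that is contractive for the maximum norm on \<open>[-1, 1]\<close> (\<open>norm_poly_action\<close>). Then
  \<open>\<psi>(f, g) = \<phi>(x f(s), g(s) y)\<close> is a bounded bilinear form on continuous functions that vanishes
  if \<open>fg = 0\<close>. A fine partition of unity, on whose pieces the function \<open>t\<close> is nearly constant,
  shows that such a form satisfies \<open>\<psi>(t, 1) = \<psi>(1, t)\<close> (\<open>identity_commutes\<close>), that is
  \<open>\<phi>(xs, y) = \<phi>(x, sy)\<close>; clearing the denominator of \<open>s\<close> gives the claim for \<open>h\<close>.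

  For the bilinear map \<open>T(b)a + bT(a)\<close> this yields
  \<open>T(c)ab + cT(ab) = T(bc)a + bcT(a)\<close>. Let one variable run through an approximate unit \<open>e\<close> and
  let \<open>\<xi>\<close> be a weak* limit point of \<open>T(e)\<close>. In the limit \<open>T(b)a + bT(a)\<close> equals both
  \<open>T(ab) + \<xi>ab\<close> and \<open>T(ab) + ab\<xi>\<close> (\<open>exists_unit_value\<close>), so that \<open>\<xi>\<close> is central. This passage to
  the limit needs that an element of the bidual which annihilates \<open>A\<close> is zero. The reason is that
  every functional is nearly of the form \<open>f(\<cdot>e)\<close>, which follows by perturbing an element at
  which \<open>f\<close> almost attains its norm (\<open>functional_almost_absorbs\<close>).

  The difference \<open>\<delta>(a) = T(a) - \<xi>a\<close> satisfies \<open>\<delta>(ab) = \<delta>(b)a + b\<delta>(a) + 2\<xi>[b, a]\<close>. Associativity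
  forces \<open>\<delta>(c)[a, b] + [c, b]\<delta>(a) = 0\<close>, from which cancellation in C*-algebras gives
  \<open>\<delta>(c)[a, b] = 0\<close> and then \<open>\<xi>[a, b] = 0\<close>. An element of the bidual that annihilates the commutator
  ideal commutes with \<open>A\<close>, so \<open>\<delta>\<close> is a derivation into a commutative bimodule. It maps
  zero products to zero products, hence \<open>\<delta>(ab)c = \<delta>(a)bc\<close> by the balancing theorem; comparing with
  the derivation rule gives \<open>\<delta>(b)ac = 0\<close>, and \<open>\<delta> = 0\<close>.
\<close>

section \<open>Elementary identities in C*-algebras\<close>

lemma scaleC_zero_left: "0 *\<^sub>C (x::'a::complex_normed_vector) = 0"
  using norm_scaleC[of 0 x] by simp

lemma scaleC_zero_right: "c *\<^sub>C (0::'a::complex_normed_vector) = 0"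
  using norm_scaleC[of c 0] by simp

lemma scaleC_one: "1 *\<^sub>C (x::'a::complex_normed_vector) = x"
  using scaleR_scaleC[of 1 x] by simp

lemma scaleC_minus_left: "(- c) *\<^sub>C (x::'a::complex_normed_vector) = - (c *\<^sub>C x)"
  using scaleC_add_left[of "- c" c x] by (simp add: scaleC_zero_left eq_neg_iff_add_eq_0)

lemma scaleC_minus_right: "c *\<^sub>C (- x::'a::complex_normed_vector) = - (c *\<^sub>C x)"
  using scaleC_add_right[of c "- x" x] by (simp add: scaleC_zero_right eq_neg_iff_add_eq_0)

lemma scaleC_diff_right: "c *\<^sub>C (x - y::'a::complex_normed_vector) = c *\<^sub>C x - c *\<^sub>C y"
  using scaleC_add_right[of c x "- y"] by (simp add: scaleC_minus_right)

lemma scaleC_i_i: "\<i> *\<^sub>C \<i> *\<^sub>C (x::'a::complex_normed_vector) = - x"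
  by (simp add: scaleC_scaleC scaleC_minus_left scaleC_one)

lemma star_zero: "star (0::'a::cstar_algebra) = 0"
  using star_add[of "0::'a" 0] by simp

lemma star_minus: "star (- x::'a::cstar_algebra) = - star x"
  using star_add[of "- x" x] by (simp add: star_zero eq_neg_iff_add_eq_0)

lemma star_diff: "star (x - y::'a::cstar_algebra) = star x - star y"
  using star_add[of x "- y"] by (simp add: star_minus)

lemma star_scaleR: "star (r *\<^sub>R x::'a::cstar_algebra) = r *\<^sub>R star x"
  by (simp add: scaleR_scaleC star_scaleC)

lemmas star_simps = star_add star_diff star_minus star_zero star_scaleR star_scaleC star_mult star_star

lemma norm_star: "norm (star x) = norm (x::'a::cstar_algebra)"
proof -
  have le: "norm y \<le> norm (star y)" for y :: 'a
  proof (cases "y = 0")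
    case False
    have "norm y * norm y \<le> norm (star y) * norm y"
      using cstar_identity[of y] norm_mult_ineq[of "star y" y] by (simp add: power2_eq_square)
    then show ?thesis using False by simp
  qed (simp add: star_zero)
  show ?thesis using le[of x] le[of "star x"] by (simp add: star_star)
qed

lemma bounded_linear_star: "bounded_linear (star :: 'a::cstar_algebra \<Rightarrow> 'a)"
  by (rule bounded_linear_intro[where K = 1]) (auto simp: star_simps norm_star)

lemma cstar_identity': "norm (x * star x) = (norm (x::'a::cstar_algebra))\<^sup>2"
  using cstar_identity[of "star x"] by (simp add: star_star norm_star)

section \<open>Isometries from self-adjoint elements\<close>

text \<open>
  The element \<open>s = 2h / (1 + h\<^sup>2)\<close>, written without a unit. It is the fixed point of the contraction
  \<open>z \<mapsto> 2h - h\<^sup>2z\<close>, and the uniqueness of fixed points makes it commute with \<open>h\<close> and self-adjoint.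
  If \<open>h\<close> is the tangent of half an angle, then \<open>s\<close> is the sine of the angle and \<open>1 - hs\<close> the cosine.
\<close>

lemma sine_of_self_adjoint:
  fixes h :: "'a::cstar_algebra"
  assumes h: "star h = h" "norm h < 1"
  obtains s where "star s = s" "s + h * h * s = 2 *\<^sub>R h" "h * s = s * h"
proof -
  have hh: "norm (h * h) < 1"
    using h(2) norm_mult_ineq[of h h] mult_strict_mono'[of "norm h" 1 "norm h" 1] by simp
  have ex1: "\<exists>!z. b - h * h * z = z" for b
  proof (rule banach_fix_type[of "norm (h * h)"])
    show "\<forall>x y. dist (b - h * h * x) (b - h * h * y) \<le> norm (h * h) * dist x y"
    proof (intro allI)
      fix x y
      have "dist (b - h * h * x) (b - h * h * y) = norm (h * h * (x - y))"
        by (simp add: dist_norm algebra_simps norm_minus_commute)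
      also have "\<dots> \<le> norm (h * h) * norm (x - y)" by (rule norm_mult_ineq)
      finally show "dist (b - h * h * x) (b - h * h * y) \<le> norm (h * h) * dist x y"
        by (simp add: dist_norm)
    qed
  qed (use hh in auto)
  then obtain s where s: "2 *\<^sub>R h - h * h * s = s" by blast
  then have s': "s + h * h * s = 2 *\<^sub>R h" by (simp add: algebra_simps)
  have "2 *\<^sub>R (h * h) - h * h * (h * s) = h * s"
    using arg_cong[OF s, of "\<lambda>z. h * z"] by (simp add: algebra_simps)
  moreover have "2 *\<^sub>R (h * h) - h * h * (s * h) = s * h"
    using arg_cong[OF s, of "\<lambda>z. z * h"] by (simp add: algebra_simps)
  ultimately have comm: "h * s = s * h" using ex1 by blast
  have comm': "h * star s = star s * h"
    using arg_cong[OF comm, of star] by (simp add: star_simps h)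
  have "2 *\<^sub>R h - star s * (h * h) = star s"
    using arg_cong[OF s, of star] by (simp add: star_simps h)
  moreover have "star s * (h * h) = h * h * star s"
    by (metis comm' mult.assoc)
  ultimately have "star s = s" using ex1 s by metis
  with s' comm that show ?thesis by blast
qed

text \<open>
  For \<open>s = 2h / (1 + h\<^sup>2)\<close> this is multiplication by the Cayley transform
  \<open>(1 + ih) / (1 - ih) = (1 - hs) + is\<close>. It is an operator and not an element because its symbol
  does not vanish at zero, so that in an algebra without unit it only exists as a multiplier.
\<close>

definition cayley_op :: "'a::cstar_algebra \<Rightarrow> 'a \<Rightarrow> 'a \<Rightarrow> 'a"
  where "cayley_op h s y = y - h * s * y + \<i> *\<^sub>C (s * y)"

locale sine =
  fixes h s :: "'a::cstar_algebra"
  assumes star_h: "star h = h" and star_s: "star s = s"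
    and sine_eq: "s + h * h * s = 2 *\<^sub>R h" and comm: "h * s = s * h"
begin

lemma comm_left: "h * (s * y) = s * (h * y)"
  using comm by (metis mult.assoc)

lemma pythagoras: "(y - h * s * y) - h * s * (y - h * s * y) + s * (s * y) = y"
proof -
  have "h * s * (h * s * y) = s * (h * h * s) * y"
    by (metis comm mult.assoc)
  also have "\<dots> = s * (2 *\<^sub>R h - s) * y"
    using sine_eq by (metis add_diff_cancel_left')
  also have "\<dots> = 2 *\<^sub>R (h * s * y) - s * (s * y)"
    by (simp add: algebra_simps comm comm_left)
  finally show ?thesis by (simp add: algebra_simps scaleR_2)
qed

lemma norm_cayley_op: "norm (cayley_op h s y) = norm y"
proof -
  define w where "w = y - h * s * y"
  define z where "z = s * y"
  have sw: "star w = star y - star y * s * h" and sz: "star z = star y * s"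
    by (simp_all add: w_def z_def star_simps star_h star_s mult.assoc)
  have "star w * z = star z * w"
    by (simp add: sw sz) (simp add: w_def z_def algebra_simps comm comm_left)
  moreover have "star w * w + star z * z = star y * y"
  proof -
    have "star w * w + star z * z = star y * ((w - s * h * w) + s * z)"
      by (simp add: sw sz algebra_simps)
    also have "(w - s * h * w) + s * z = y"
      using pythagoras[of y] by (simp add: w_def z_def comm)
    finally show ?thesis .
  qed
  ultimately have "star (cayley_op h s y) * cayley_op h s y = star y * y"
    unfolding cayley_op_def w_def[symmetric] z_def[symmetric]
    by (simp add: star_simps algebra_simps mult_scaleC_left mult_scaleC_right scaleC_diff_right
        scaleC_minus_left scaleC_i_i)
  then have "(norm (cayley_op h s y))\<^sup>2 = (norm y)\<^sup>2"
    by (metis cstar_identity)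
  then show ?thesis by simp
qed

text \<open>
  On the unit circle, \<open>z\<^sup>2 - 1 = 2iz Im z\<close>. Multiplication by \<open>s\<close> is thus the imaginary part of the
  isometry, expressed without its inverse.
\<close>

lemma cayley_op_square: "cayley_op h s (cayley_op h s y) - y = (2 * \<i>) *\<^sub>C (s * cayley_op h s y)"
proof -
  define C where "C = (\<lambda>y. y - h * s * y)"
  have C: "C (u + v) = C u + C v" "C (c *\<^sub>C u) = c *\<^sub>C C u" for u v c
    by (auto simp: C_def algebra_simps mult_scaleC_right scaleC_diff_right)
  have U: "cayley_op h s u = C u + \<i> *\<^sub>C (s * u)" for u
    by (simp add: cayley_op_def C_def)
  have Cs: "C (s * u) = s * C u" for u
    by (simp add: C_def algebra_simps comm comm_left)
  have CC: "C (C y) = y - s * (s * y)"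
    using pythagoras[of y] unfolding C_def by (simp add: algebra_simps)
  have two: "(2 * \<i>) *\<^sub>C v = \<i> *\<^sub>C v + \<i> *\<^sub>C v" for v :: 'a
    by (simp add: scaleC_add_left[symmetric])
  show ?thesis
    by (simp add: U C Cs CC two distrib_left mult_scaleC_right scaleC_add_right scaleC_i_i)
qed

lemma cayley_op_commute: "cayley_op h s (s * y) = s * cayley_op h s y"
  by (simp add: cayley_op_def algebra_simps mult_scaleC_right comm comm_left)

end

section \<open>Coefficient bounds for polynomials on the unit circle\<close>

lemma deriv_poly: "deriv (poly p) = poly (pderiv p)" for p :: "complex poly"
  by (rule ext, rule DERIV_imp_deriv, rule poly_DERIV)

lemma higher_deriv_poly: "(deriv ^^ n) (poly p) = poly ((pderiv ^^ n) p)" for p :: "complex poly"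
  by (induction n) (simp_all add: deriv_poly)

text \<open>
  Cauchy's inequality on the unit disc.
\<close>

lemma coeff_bound_unit_circle:
  fixes P :: "complex poly" and M :: real
  assumes "\<And>z. cmod z = 1 \<Longrightarrow> cmod (poly P z) \<le> M"
  shows "cmod (poly.coeff P k) \<le> M"
proof -
  have "norm ((deriv ^^ k) (poly P) 0) \<le> fact k * M / 1 ^ k"
    by (rule Cauchy_inequality) (use assms in \<open>auto intro!: holomorphic_intros continuous_intros\<close>)
  moreover have "(deriv ^^ k) (poly P) 0 = fact k * poly.coeff P k"
    by (simp add: higher_deriv_poly poly_0_coeff_0 coeff_higher_pderiv pochhammer_fact)
  ultimately show ?thesis by (simp add: norm_mult)
qed

lemma sum_norm_coeffs_unit_circle:
  fixes P :: "complex poly" and M :: real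
  assumes "\<And>z. cmod z = 1 \<Longrightarrow> cmod (poly P z) \<le> M"
  shows "(\<Sum>c\<leftarrow>coeffs P. cmod c) \<le> (Polynomial.degree P + 1) * M"
proof -
  have "cmod (poly P 1) \<le> M" using assms by simp
  then have M: "0 \<le> M" using norm_ge_zero order_trans by blast
  have "sum_list (map cmod (coeffs P)) \<le> sum_list (map (\<lambda>_. M) (coeffs P))"
  proof (rule sum_list_mono)
    fix c assume "c \<in> set (coeffs P)"
    then obtain k where "c = poly.coeff P k"
      by (auto simp: coeffs_def split: if_splits)
    then show "cmod c \<le> M" using coeff_bound_unit_circle assms by simp
  qed
  also have "\<dots> = length (coeffs P) * M" by (simp add: sum_list_triv)
  also have "\<dots> \<le> (Polynomial.degree P + 1) * M"
    using M by (cases "P = 0") (auto simp: length_coeffs_degree intro!: mult_right_mono)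
  finally show ?thesis .
qed

section \<open>Polynomial functional calculus\<close>

text \<open>
  The element \<open>p(s)y\<close>. The constant term acts as a multiple of the identity, which again is only a
  multiplier.
\<close>

definition poly_action :: "'a::cstar_algebra \<Rightarrow> real poly \<Rightarrow> 'a \<Rightarrow> 'a"
  where "poly_action s p = fold_coeffs (\<lambda>a f y. a *\<^sub>R y + s * f y) p (\<lambda>y. 0)"

lemma poly_action_0 [simp]: "poly_action s 0 y = 0"
  by (simp add: poly_action_def)

lemma poly_action_pCons [simp]:
  "poly_action s (pCons a p) y = a *\<^sub>R y + s * poly_action s p y"
  by (cases "p = 0 \<and> a = 0") (auto simp: poly_action_def)

lemma poly_action_1 [simp]: "poly_action s 1 y = y"
  by (simp add: one_pCons)

lemma poly_action_add: "poly_action s (p + q) y = poly_action s p y + poly_action s q y"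
  by (induction p q rule: poly_induct2) (simp_all add: algebra_simps)

lemma poly_action_smult: "poly_action s (smult c p) y = c *\<^sub>R poly_action s p y"
  by (induction p) (simp_all add: algebra_simps)

lemma poly_action_diff: "poly_action s (p - q) y = poly_action s p y - poly_action s q y"
  using poly_action_add[of s "p - q" q y] by (simp add: algebra_simps)

lemma poly_action_mult: "poly_action s (p * q) y = poly_action s p (poly_action s q y)"
  by (induction p) (simp_all add: poly_action_add poly_action_smult)

lemma poly_action_scaleC_right: "poly_action s p (c *\<^sub>C y) = c *\<^sub>C poly_action s p y"
  by (induction p) (simp_all add: scaleR_scaleC scaleC_scaleC scaleC_add_right mult_scaleC_right
      scaleC_zero_right mult.commute)

lemma poly_action_scaleR_right: "poly_action s p (c *\<^sub>R y) = c *\<^sub>R poly_action s p y"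
  by (simp add: scaleR_scaleC poly_action_scaleC_right)

lemma poly_action_mult_right: "poly_action s p (y * z) = poly_action s p y * z"
  by (induction p) (simp_all add: algebra_simps)

lemma poly_action_commute: "s * poly_action s p y = poly_action s p (s * y)"
  by (induction p) (simp_all add: algebra_simps)

lemma poly_action_symmetric:
  assumes "star s = s"
  shows "star (poly_action s p x) * y = star x * poly_action s p y"
proof (induction p arbitrary: y)
  case (pCons a p)
  have "star (s * poly_action s p x) * y = star (poly_action s p x) * (s * y)"
    by (simp add: star_simps assms mult.assoc)
  also have "\<dots> = star x * (s * poly_action s p y)"
    by (simp add: pCons.IH poly_action_commute)
  finally show ?case
    using pCons.IH[of y] by (simp add: star_add star_scaleR distrib_left distrib_right)
qed (simp add: star_simps)

definition operator_poly :: "('a::complex_normed_vector \<Rightarrow> 'a) \<Rightarrow> complex poly \<Rightarrow> 'a \<Rightarrow> 'a"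
  where "operator_poly U P = fold_coeffs (\<lambda>a f y. a *\<^sub>C y + U (f y)) P (\<lambda>y. 0)"

context
  fixes U :: "'a::complex_normed_vector \<Rightarrow> 'a"
  assumes U_add: "U (x + y) = U x + U y" and U_scaleC: "U (c *\<^sub>C x) = c *\<^sub>C U x"
begin

lemma operator_zero: "U 0 = 0"
  using U_add[of 0 0] by simp

lemma operator_poly_0: "operator_poly U 0 y = 0"
  by (simp add: operator_poly_def)

lemma operator_poly_pCons:
  "operator_poly U (pCons a P) y = a *\<^sub>C y + U (operator_poly U P y)"
  by (cases "P = 0 \<and> a = 0") (auto simp: operator_poly_def scaleC_zero_left operator_zero)

lemma operator_poly_add: "operator_poly U (P + Q) y = operator_poly U P y + operator_poly U Q y"
  by (induction P Q rule: poly_induct2)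
    (simp_all add: operator_poly_0 operator_poly_pCons U_add scaleC_add_left algebra_simps)

lemma operator_poly_smult: "operator_poly U (smult c P) y = c *\<^sub>C operator_poly U P y"
  by (induction P)
    (simp_all add: operator_poly_0 operator_poly_pCons U_scaleC scaleC_scaleC scaleC_add_right
      scaleC_zero_right)

lemma operator_poly_monom: "operator_poly U (Polynomial.monom c k) y = c *\<^sub>C (U ^^ k) y"
  by (induction k)
    (simp_all add: operator_poly_0 operator_poly_pCons U_scaleC operator_zero monom_0 monom_Suc scaleC_zero_left)

lemma norm_operator_poly:
  assumes "\<And>x. norm (U x) = norm x"
  shows "norm (operator_poly U P y) \<le> (\<Sum>c\<leftarrow>coeffs P. cmod c) * norm y"
proof (induction P)
  case (pCons a P)
  have "norm (operator_poly U (pCons a P) y) \<le> cmod a * norm y + norm (operator_poly U P y)"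
    unfolding operator_poly_pCons
    by (rule order_trans[OF norm_triangle_ineq]) (simp add: norm_scaleC assms)
  with pCons show ?case by (auto simp: cCons_def algebra_simps operator_poly_0)
qed (simp add: operator_poly_0)

end

context sine
begin

abbreviation "U \<equiv> cayley_op h s"

lemma U_add: "U (x + y) = U x + U y"
  by (simp add: cayley_op_def algebra_simps scaleC_add_right)

lemma U_scaleC: "U (c *\<^sub>C x) = c *\<^sub>C U x"
  by (simp add: cayley_op_def mult_scaleC_right scaleC_add_right scaleC_diff_right scaleC_scaleC mult.commute)

lemmas operator_poly_U =
  operator_poly_add[of U, OF U_add U_scaleC] operator_poly_smult[of U, OF U_add U_scaleC]
  operator_poly_monom[of U, OF U_add U_scaleC] operator_poly_pCons[of U, OF U_add U_scaleC]
  operator_poly_0[of U, OF U_add U_scaleC]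

lemma funpow_U: "(U ^^ n) (x + y) = (U ^^ n) x + (U ^^ n) y" "(U ^^ n) (c *\<^sub>C x) = c *\<^sub>C (U ^^ n) x"
  "(U ^^ n) (s * x) = s * (U ^^ n) x" "norm ((U ^^ n) x) = norm x"
  by (induction n) (simp_all add: U_add U_scaleC cayley_op_commute norm_cayley_op)

text \<open>
  The substitution \<open>t = Im z\<close> turns a real polynomial in \<open>s\<close>, after multiplication by a power of the
  isometry that clears the negative powers of \<open>z\<close>, into a complex polynomial in the isometry. The
  multiplication changes neither the norm of \<open>p(s)y\<close> nor the maximum on the circle.
\<close>

lemma circle_polynomial:
  obtains P where "Polynomial.degree P \<le> 2 * length (coeffs p)"
    "\<And>z. cmod z = 1 \<Longrightarrow> poly P z = z ^ length (coeffs p) * complex_of_real (poly p (Im z))"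
    "\<And>y. (U ^^ length (coeffs p)) (poly_action s p y) = operator_poly U P y"
proof -
  have "\<exists>P. Polynomial.degree P \<le> 2 * length (coeffs p) \<and>
    (\<forall>z. cmod z = 1 \<longrightarrow> poly P z = z ^ length (coeffs p) * complex_of_real (poly p (Im z))) \<and>
    (\<forall>y. (U ^^ length (coeffs p)) (poly_action s p y) = operator_poly U P y)"
  proof (induction p)
    case 0
    show ?case by (rule exI[of _ 0]) (simp add: operator_poly_U)
  next
    case (pCons a p)
    then obtain P where P: "Polynomial.degree P \<le> 2 * length (coeffs p)"
      "\<And>z. cmod z = 1 \<Longrightarrow> poly P z = z ^ length (coeffs p) * complex_of_real (poly p (Im z))"
      "\<And>y. (U ^^ length (coeffs p)) (poly_action s p y) = operator_poly U P y"
      by blast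
    define d where "d = length (coeffs p)"
    have d': "length (coeffs (pCons a p)) = Suc d"
      using pCons(1) by (auto simp: d_def cCons_def)
    define Q where "Q = Polynomial.monom (complex_of_real a) (Suc d) +
      smult (1 / (2 * \<i>)) (pCons 0 (pCons 0 P) + smult (-1) P)"
    have "Polynomial.degree Q \<le> 2 * Suc d"
      unfolding Q_def
      by (intro degree_add_le order_trans[OF degree_smult_le] order_trans[OF degree_monom_le]
          order_trans[OF degree_pCons_le]) (use P(1) in \<open>auto simp: d_def\<close>)
    moreover have "poly Q z = z ^ Suc d * complex_of_real (poly (pCons a p) (Im z))" if "cmod z = 1" for z
    proof -
      have "z * cnj z = 1" using that by (simp add: complex_norm_square[symmetric] complex_mult_cnj cmod_def)
      moreover have "z - cnj z = 2 * \<i> * complex_of_real (Im z)"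
        by (simp add: complex_eq_iff)
      ultimately have *: "z\<^sup>2 - 1 = 2 * \<i> * (z * complex_of_real (Im z))"
        by (simp add: power2_eq_square right_diff_distrib mult.left_commute flip: \<open>z - cnj z = _\<close>)
      have "poly Q z = of_real a * z ^ Suc d + (1 / (2 * \<i>)) * ((z\<^sup>2 - 1) * poly P z)"
        by (simp add: Q_def poly_monom power2_eq_square algebra_simps)
      also have "\<dots> = z ^ Suc d * complex_of_real (poly (pCons a p) (Im z))"
        unfolding * using P(2)[OF that] by (simp add: d_def algebra_simps)
      finally show ?thesis .
    qed
    moreover have "(U ^^ Suc d) (poly_action s (pCons a p) y) = operator_poly U Q y" for y
    proof -
      define W where "W = operator_poly U P y"
      have W: "W = (U ^^ d) (poly_action s p y)" by (simp add: W_def P(3) d_def)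
      have "(2 * \<i>) *\<^sub>C (s * U W) = U (U W) - W"
        by (simp add: cayley_op_square)
      then have sUW: "(1 / (2 * \<i>)) *\<^sub>C (U (U W) - W) = s * U W"
        using scaleC_scaleC[of "1 / (2 * \<i>)" "2 * \<i>" "s * U W"] by (simp only: scaleC_one) (simp add: scaleC_one)
      have "(U ^^ Suc d) (poly_action s (pCons a p) y) =
          complex_of_real a *\<^sub>C (U ^^ Suc d) y + s * U W"
        by (simp add: W scaleR_scaleC funpow_U U_add U_scaleC cayley_op_commute)
      also have "\<dots> = operator_poly U Q y"
        by (simp only: sUW[symmetric] Q_def operator_poly_U W_def[symmetric]) (simp add: W_def[symmetric] scaleC_zero_left scaleC_minus_left scaleC_one
            del: funpow.simps)
      finally show ?thesis .
    qed
    ultimately show ?case unfolding d' by blast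
  qed
  with that show ?thesis by blast
qed

text \<open>
  An isometry is a contraction, so the norm is at most the sum of the moduli of the coefficients on
  the circle. The bound is too large, but only by a factor linear in the degree.
\<close>

lemma norm_poly_action_crude:
  fixes M :: real
  assumes "\<And>t. \<bar>t\<bar> \<le> 1 \<Longrightarrow> \<bar>poly p t\<bar> \<le> M"
  shows "norm (poly_action s p y) \<le> (2 * length (coeffs p) + 1) * M * norm y"
proof -
  have M: "0 \<le> M" using assms[of 0] by simp
  obtain P where P: "Polynomial.degree P \<le> 2 * length (coeffs p)"
    "\<And>z. cmod z = 1 \<Longrightarrow> poly P z = z ^ length (coeffs p) * complex_of_real (poly p (Im z))"
    "\<And>y. (U ^^ length (coeffs p)) (poly_action s p y) = operator_poly U P y"
    using circle_polynomial by blast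
  have "cmod (poly P z) \<le> M" if "cmod z = 1" for z
    using P(2)[OF that] assms[of "Im z"] abs_Im_le_cmod[of z] that
    by (simp add: norm_mult norm_power)
  then have *: "(\<Sum>c\<leftarrow>coeffs P. cmod c) \<le> (Polynomial.degree P + 1) * M"
    by (rule sum_norm_coeffs_unit_circle)
  also have "\<dots> \<le> (2 * length (coeffs p) + 1) * M"
    using P(1) M by (intro mult_right_mono) linarith+
  finally have "(\<Sum>c\<leftarrow>coeffs P. cmod c) * norm y \<le> (2 * length (coeffs p) + 1) * M * norm y"
    by (rule mult_right_mono) simp
  moreover have "norm (poly_action s p y) = norm (operator_poly U P y)"
    by (metis P(3) funpow_U(4))
  ultimately show ?thesis
    using norm_operator_poly[of U P y, OF U_add U_scaleC norm_cayley_op] by simp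
qed

lemma norm_poly_action_square:
  "(norm (poly_action s p y))\<^sup>2 \<le> norm y * norm (poly_action s (p\<^sup>2) y)"
proof -
  have "(norm (poly_action s p y))\<^sup>2 = norm (star (poly_action s p y) * poly_action s p y)"
    by (simp add: cstar_identity)
  also have "\<dots> = norm (star y * poly_action s (p\<^sup>2) y)"
    by (simp add: poly_action_symmetric[OF star_s] power2_eq_square poly_action_mult)
  also have "\<dots> \<le> norm y * norm (poly_action s (p\<^sup>2) y)"
    by (metis norm_mult_ineq norm_star)
  finally show ?thesis .
qed

lemma norm_poly_action_power:
  assumes "norm y \<le> 1"
  shows "norm (poly_action s p y) ^ (2 ^ n) \<le> norm (poly_action s (p ^ (2 ^ n)) y)"
proof (induction n arbitrary: p)
  case (Suc n)
  have "norm (poly_action s p y) ^ (2 ^ Suc n) = ((norm (poly_action s p y))\<^sup>2) ^ (2 ^ n)"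
    by (simp add: power_mult)
  also have "\<dots> \<le> norm (poly_action s (p\<^sup>2) y) ^ (2 ^ n)"
  proof (rule power_mono)
    have "norm y * norm (poly_action s (p\<^sup>2) y) \<le> 1 * norm (poly_action s (p\<^sup>2) y)"
      using assms by (intro mult_right_mono) auto
    then show "(norm (poly_action s p y))\<^sup>2 \<le> norm (poly_action s (p\<^sup>2) y)"
      using norm_poly_action_square[of p y] by simp
  qed simp
  also have "\<dots> \<le> norm (poly_action s ((p\<^sup>2) ^ (2 ^ n)) y)" by (rule Suc.IH)
  finally show ?case by (simp add: power_mult)
qed simp

text \<open>
  The C*-identity compares \<open>p(s)\<close> with its \<open>2\<^sup>n\<close>-th power. For that power the excess factor of
  the crude estimate grows only linearly in \<open>2\<^sup>n\<close>, and its \<open>2\<^sup>n\<close>-th root tends to one.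
\<close>

theorem norm_poly_action:
  fixes M :: real
  assumes M: "\<And>t. \<bar>t\<bar> \<le> 1 \<Longrightarrow> \<bar>poly p t\<bar> \<le> M"
  shows "norm (poly_action s p y) \<le> M * norm y"
proof -
  have M0: "0 \<le> M" using M[of 0] by simp
  have unit: "norm (poly_action s p y) \<le> M" if y: "norm y \<le> 1" for y
  proof (rule ccontr)
    define a where "a = norm (poly_action s p y)"
    define D where "D = Polynomial.degree p"
    assume "\<not> norm (poly_action s p y) \<le> M"
    then have a: "M < a" "0 < a" using M0 by (auto simp: a_def)
    define c where "c = M / a"
    have c: "norm c < 1" using a M0 by (simp add: c_def)
    have "(\<lambda>n. 2 * real D * (real n * c ^ n) + 3 * c ^ n) \<longlonglongrightarrow> 2 * real D * 0 + 3 * 0"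
      by (intro tendsto_intros powser_times_n_limit_0[OF c] LIMSEQ_power_zero[OF c])
    then have "eventually (\<lambda>n. 2 * real D * (real n * c ^ n) + 3 * c ^ n < 1) sequentially"
      by (intro order_tendstoD) auto
    then obtain n where n: "\<And>N. N \<ge> n \<Longrightarrow> 2 * real D * (real N * c ^ N) + 3 * c ^ N < 1"
      by (auto simp: eventually_sequentially)
    define N :: nat where "N = 2 ^ n"
    have "n \<le> N" by (simp add: N_def less_imp_le)
    have "length (coeffs (p ^ N)) \<le> D * N + 1"
      using degree_power_le[of p N]
      by (cases "p ^ N = 0") (auto simp: length_coeffs_degree D_def simp del: power_eq_0_iff)
    have "a ^ N \<le> norm (poly_action s (p ^ N) y)"
      unfolding a_def N_def by (rule norm_poly_action_power[OF y])
    also have "\<dots> \<le> (2 * length (coeffs (p ^ N)) + 1) * M ^ N * norm y"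
    proof (rule norm_poly_action_crude)
      show "\<bar>poly (p ^ N) t\<bar> \<le> M ^ N" if "\<bar>t\<bar> \<le> 1" for t
        using power_mono[OF M[OF that], of N] by (simp add: poly_power power_abs)
    qed
    also have "\<dots> \<le> (2 * length (coeffs (p ^ N)) + 1) * M ^ N * 1"
      using y M0 by (intro mult_left_mono) auto
    also have "\<dots> \<le> (2 * (D * N + 1) + 1) * M ^ N * 1"
      using \<open>length _ \<le> D * N + 1\<close> M0 by (intro mult_right_mono) (auto simp del: of_nat_mult of_nat_add simp: of_nat_mono)
    finally have "a ^ N \<le> (2 * D * N + 3) * M ^ N" by (simp add: algebra_simps)
    then have "1 \<le> (2 * D * N + 3) * c ^ N"
      using a by (simp add: c_def power_divide field_simps)
    with n[OF \<open>n \<le> N\<close>] show False by (simp add: algebra_simps)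
  qed
  show ?thesis
  proof (cases "y = 0")
    case True
    have "poly_action s p (0 *\<^sub>R 0) = 0" by (simp only: poly_action_scaleR_right) simp
    then show ?thesis using True by simp
  next
    case False
    have "norm (poly_action s p ((1 / norm y) *\<^sub>R y)) \<le> M"
      using False by (intro unit) simp
    then show ?thesis using False by (simp add: poly_action_scaleR_right field_simps)
  qed
qed

end

section \<open>Bilinear forms on C[-1, 1] that vanish on disjointly supported functions\<close>

abbreviation cont :: "(real \<Rightarrow> real) \<Rightarrow> bool"
  where "cont f \<equiv> continuous_on {-1..1} f"

lemma abs_sum_disjoint_le:
  fixes a :: "'i \<Rightarrow> real"
  assumes "finite A" "0 \<le> M" "\<And>i. i \<in> A \<Longrightarrow> \<bar>a i\<bar> \<le> M"
    "\<And>i j. i \<in> A \<Longrightarrow> j \<in> A \<Longrightarrow> i \<noteq> j \<Longrightarrow> a i = 0 \<or> a j = 0"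
  shows "\<bar>sum a A\<bar> \<le> M"
proof (cases "\<exists>i\<in>A. a i \<noteq> 0")
  case True
  then obtain i where i: "i \<in> A" "a i \<noteq> 0" by blast
  then have "sum a A = a i + sum a (A - {i})" using assms(1) by (simp add: sum.remove)
  also have "sum a (A - {i}) = 0" using assms(4) i by (intro sum.neutral) blast
  finally show ?thesis using assms(3) i by simp
qed (use assms(2) in \<open>simp add: sum.neutral\<close>)

text \<open>
  The linearity and boundedness of \<open>\<psi>\<close> are only required for functions that are continuous on
  \<open>[-1, 1]\<close>, and for the maximum norm there.
\<close>

locale disjointness_form =
  fixes \<psi> :: "(real \<Rightarrow> real) \<Rightarrow> (real \<Rightarrow> real) \<Rightarrow> 'v::real_normed_vector" and K :: real
  assumes add_left: "cont f \<Longrightarrow> cont f' \<Longrightarrow> cont g \<Longrightarrow> \<psi> (\<lambda>t. f t + f' t) g = \<psi> f g + \<psi> f' g"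
    and add_right: "cont f \<Longrightarrow> cont g \<Longrightarrow> cont g' \<Longrightarrow> \<psi> f (\<lambda>t. g t + g' t) = \<psi> f g + \<psi> f g'"
    and scale_left: "cont f \<Longrightarrow> cont g \<Longrightarrow> \<psi> (\<lambda>t. c * f t) g = c *\<^sub>R \<psi> f g"
    and scale_right: "cont f \<Longrightarrow> cont g \<Longrightarrow> \<psi> f (\<lambda>t. c * g t) = c *\<^sub>R \<psi> f g"
    and bound: "cont f \<Longrightarrow> cont g \<Longrightarrow> (\<And>t. \<bar>t\<bar> \<le> 1 \<Longrightarrow> \<bar>f t\<bar> \<le> M) \<Longrightarrow>
      (\<And>t. \<bar>t\<bar> \<le> 1 \<Longrightarrow> \<bar>g t\<bar> \<le> N) \<Longrightarrow> norm (\<psi> f g) \<le> K * M * N"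
    and disjoint: "cont f \<Longrightarrow> cont g \<Longrightarrow> (\<And>t. \<bar>t\<bar> \<le> 1 \<Longrightarrow> f t = 0 \<or> g t = 0) \<Longrightarrow> \<psi> f g = 0"
begin

lemma local_left:
  assumes "cont f" "cont f'" "cont g" "\<And>t. \<bar>t\<bar> \<le> 1 \<Longrightarrow> f t = f' t \<or> g t = 0"
  shows "\<psi> f g = \<psi> f' g"
proof -
  have "\<psi> (\<lambda>t. f t + (-1) * f' t) g = 0"
    by (rule disjoint) (use assms in \<open>force intro!: continuous_intros\<close>)+
  moreover have "\<psi> (\<lambda>t. f t + (-1) * f' t) g = \<psi> f g + \<psi> (\<lambda>t. (-1) * f' t) g"
    by (rule add_left) (use assms in \<open>auto intro!: continuous_intros\<close>)
  ultimately show ?thesis using scale_left[OF assms(2,3), of "-1"] by simp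
qed

lemma local_right:
  assumes "cont f" "cont g" "cont g'" "\<And>t. \<bar>t\<bar> \<le> 1 \<Longrightarrow> g t = g' t \<or> f t = 0"
  shows "\<psi> f g = \<psi> f g'"
proof -
  have "\<psi> f (\<lambda>t. g t + (-1) * g' t) = 0"
    by (rule disjoint) (use assms in \<open>force intro!: continuous_intros\<close>)+
  moreover have "\<psi> f (\<lambda>t. g t + (-1) * g' t) = \<psi> f g + \<psi> f (\<lambda>t. (-1) * g' t)"
    by (rule add_right) (use assms in \<open>auto intro!: continuous_intros\<close>)
  ultimately show ?thesis using scale_right[OF assms(1,3), of "-1"] by simp
qed

lemma sum_left:
  assumes "finite A" "\<And>i. i \<in> A \<Longrightarrow> cont (f i)" "cont g"
  shows "\<psi> (\<lambda>t. \<Sum>i\<in>A. f i t) g = (\<Sum>i\<in>A. \<psi> (f i) g)"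
  using assms
proof (induction A)
  case empty
  then show ?case by (simp add: disjoint)
next
  case (insert i A)
  then have "\<psi> (\<lambda>t. f i t + (\<Sum>i\<in>A. f i t)) g = \<psi> (f i) g + \<psi> (\<lambda>t. \<Sum>i\<in>A. f i t) g"
    by (intro add_left continuous_on_sum) auto
  with insert show ?case by simp
qed

lemma sum_right:
  assumes "finite A" "\<And>i. i \<in> A \<Longrightarrow> cont (g i)" "cont f"
  shows "\<psi> f (\<lambda>t. \<Sum>i\<in>A. g i t) = (\<Sum>i\<in>A. \<psi> f (g i))"
  using assms
proof (induction A)
  case empty
  then show ?case by (simp add: disjoint)
next
  case (insert i A)
  then have "\<psi> f (\<lambda>t. g i t + (\<Sum>i\<in>A. g i t)) = \<psi> f (g i) + \<psi> f (\<lambda>t. \<Sum>i\<in>A. g i t)"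
    by (intro add_right continuous_on_sum) auto
  with insert show ?case by simp
qed

text \<open>
  Disjointness of the supports replaces a sum of many values of \<open>\<psi>\<close> by a single value, so that the
  estimate does not deteriorate with the number of summands.
\<close>

lemma sum_diagonal:
  assumes "finite A" "\<And>i. i \<in> A \<Longrightarrow> cont (f i)" "\<And>i. i \<in> A \<Longrightarrow> cont (g i)"
    "\<And>i j t. i \<in> A \<Longrightarrow> j \<in> A \<Longrightarrow> i \<noteq> j \<Longrightarrow> f i t = 0 \<or> g j t = 0"
  shows "(\<Sum>i\<in>A. \<psi> (f i) (g i)) = \<psi> (\<lambda>t. \<Sum>i\<in>A. f i t) (\<lambda>t. \<Sum>i\<in>A. g i t)"
proof -
  have "\<psi> (\<lambda>t. \<Sum>i\<in>A. f i t) (\<lambda>t. \<Sum>i\<in>A. g i t) = (\<Sum>i\<in>A. \<Sum>j\<in>A. \<psi> (f i) (g j))"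
    using assms by (simp add: sum_left sum_right continuous_on_sum)
  also have "\<dots> = (\<Sum>i\<in>A. \<psi> (f i) (g i))"
  proof (rule sum.cong)
    fix i assume i: "i \<in> A"
    have "(\<Sum>j\<in>A. \<psi> (f i) (g j)) = \<psi> (f i) (g i) + (\<Sum>j\<in>A - {i}. \<psi> (f i) (g j))"
      using assms(1) i by (simp add: sum.remove)
    also have "(\<Sum>j\<in>A - {i}. \<psi> (f i) (g j)) = 0"
      using assms i by (intro sum.neutral ballI disjoint) blast+
    finally show "(\<Sum>j\<in>A. \<psi> (f i) (g j)) = \<psi> (f i) (g i)" by simp
  qed simp
  finally show ?thesis by simp
qed

text \<open>
  Write \<open>1\<close> as a sum of tents \<open>\<tau>\<close> of width \<open>2/n\<close>. Near each tent the function \<open>t\<close> may be replaced by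
  its value at the node, at the price of an error of size \<open>1/n\<close>, and for constants both sides agree.
  The errors do not add up over the tents: those whose indices agree modulo \<open>4\<close> have disjoint
  neighbourhoods, so their total contribution is one value of \<open>\<psi>\<close> of size \<open>1/n\<close>.
\<close>

lemma norm_commutation_defect:
  assumes n: "0 < n"
  shows "norm (\<psi> (\<lambda>t. t) (\<lambda>_. 1) - \<psi> (\<lambda>_. 1) (\<lambda>t. t)) \<le> 12 * K / real n"
proof -
  define c :: "real \<Rightarrow> real" where "c x = max 0 (min 1 x)" for x
  define u :: "real \<Rightarrow> real" where "u t = real n * t + real n" for t
  \<comment> \<open>Consecutive differences of a ramp: the tents telescope to 1 on \<open>[-1, 1]\<close>.\<close>
  define \<tau> where "\<tau> i t = c (u t - real i + 1) - c (u t - real i)" for i t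
  \<comment> \<open>A plateau equal to 1 on the support of the tent, by which the other argument is localised.\<close>
  define \<kappa> where "\<kappa> i t = c (2 - \<bar>u t - real i\<bar>)" for i t
  define node where "node i = (real i - real n) / real n" for i :: nat
  define a where "a i t = (t - node i) * \<tau> i t" for i t
  define b where "b i t = (t - node i) * \<kappa> i t" for i t
  have cu: "cont u" unfolding u_def by (intro continuous_intros)
  have cc: "cont (\<lambda>t. c (f t))" if "cont f" for f
    unfolding c_def by (intro continuous_intros that)
  have c\<tau>: "cont (\<tau> i)" and c\<kappa>: "cont (\<kappa> i)" for i
    unfolding \<tau>_def[abs_def] \<kappa>_def[abs_def] by (intro continuous_intros cc cu)+
  have ca: "cont (a i)" and cb: "cont (b i)" for i
    unfolding a_def[abs_def] b_def[abs_def] by (intro continuous_intros c\<tau> c\<kappa>)+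
  note conts = c\<tau> c\<kappa> ca cb
  have \<tau>1: "\<bar>\<tau> i t\<bar> \<le> 1" and \<kappa>1: "\<bar>\<kappa> i t\<bar> \<le> 1" for i t
    by (auto simp: \<tau>_def \<kappa>_def c_def)
  have \<tau>0: "\<tau> i t = 0" if "1 \<le> \<bar>u t - i\<bar>" for i t
    using that by (auto simp: \<tau>_def c_def abs_if split: if_splits)
  have \<kappa>0: "\<kappa> i t = 0" if "2 \<le> \<bar>u t - i\<bar>" for i t
    using that by (auto simp: \<kappa>_def c_def)
  have \<kappa>\<tau>: "\<kappa> i t = 1 \<or> \<tau> i t = 0" for i t
    using \<tau>0[of t i] by (cases "1 \<le> \<bar>u t - i\<bar>") (auto simp: \<kappa>_def c_def)
  have node: "\<bar>t - node i\<bar> = \<bar>u t - i\<bar> / n" for i t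
  proof -
    have "t - node i = (u t - i) / n" using n by (simp add: node_def u_def field_simps)
    then show ?thesis by simp
  qed
  have a1: "\<bar>a i t\<bar> \<le> 1 / n" for i t
  proof (cases "1 \<le> \<bar>u t - i\<bar>")
    case False
    then have "\<bar>t - node i\<bar> * \<bar>\<tau> i t\<bar> \<le> (1 / n) * 1"
      using \<tau>1 n by (intro mult_mono) (auto simp: node divide_right_mono)
    then show ?thesis by (simp add: a_def abs_mult)
  qed (simp add: a_def \<tau>0)
  have b1: "\<bar>b i t\<bar> \<le> 2 / n" for i t
  proof (cases "2 \<le> \<bar>u t - i\<bar>")
    case False
    then have "\<bar>t - node i\<bar> * \<bar>\<kappa> i t\<bar> \<le> (2 / n) * 1"
      using \<kappa>1 n by (intro mult_mono) (auto simp: node divide_right_mono)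
    then show ?thesis by (simp add: b_def abs_mult)
  qed (simp add: b_def \<kappa>0)
  have b_eq: "t = b i t + node i * 1 \<or> \<tau> i t = 0" for i t
    using \<kappa>\<tau>[of i t] by (auto simp: b_def)
  have partition: "(\<Sum>i<2 * n + 1. \<tau> i t) = 1" if "\<bar>t\<bar> \<le> 1" for t
  proof -
    have "(\<Sum>i<m. \<tau> i t) = c (u t + 1) - c (u t - real m + 1)" for m
      by (induction m) (simp_all add: \<tau>_def algebra_simps)
    moreover have "0 \<le> real n * t + real n" "real n * t \<le> real n"
      using that n mult_left_mono[of "-1" t "real n"] mult_left_mono[of t 1 "real n"] by (auto simp: abs_le_iff)
    ultimately show ?thesis by (simp add: c_def u_def)
  qed

  have "\<psi> (\<lambda>t. t) (\<lambda>_. 1) = \<psi> (\<lambda>t. \<Sum>i<2 * n + 1. t * \<tau> i t) (\<lambda>_. 1)"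
    using partition by (intro local_left continuous_intros conts) (simp add: sum_distrib_left[symmetric])
  also have "\<dots> = (\<Sum>i<2 * n + 1. \<psi> (\<lambda>t. t * \<tau> i t) (\<lambda>_. 1))"
    by (intro sum_left continuous_intros conts) simp
  also have "\<dots> = (\<Sum>i<2 * n + 1. \<psi> (a i) (\<kappa> i) + node i *\<^sub>R \<psi> (\<tau> i) (\<lambda>_. 1))"
  proof (rule sum.cong)
    fix i
    have "\<psi> (\<lambda>t. t * \<tau> i t) (\<lambda>_. 1) = \<psi> (\<lambda>t. a i t + node i * \<tau> i t) (\<lambda>_. 1)"
      by (simp add: a_def algebra_simps)
    also have "\<dots> = \<psi> (a i) (\<lambda>_. 1) + node i *\<^sub>R \<psi> (\<tau> i) (\<lambda>_. 1)"
      by (subst add_left) (auto intro!: continuous_intros conts scale_left)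
    also have "\<psi> (a i) (\<lambda>_. 1) = \<psi> (a i) (\<kappa> i)"
      using \<kappa>\<tau>[of i] by (intro local_right continuous_intros conts) (auto simp: a_def)
    finally show "\<psi> (\<lambda>t. t * \<tau> i t) (\<lambda>_. 1) = \<psi> (a i) (\<kappa> i) + node i *\<^sub>R \<psi> (\<tau> i) (\<lambda>_. 1)" .
  qed simp
  finally have 1: "\<psi> (\<lambda>t. t) (\<lambda>_. 1) =
    (\<Sum>i<2 * n + 1. \<psi> (a i) (\<kappa> i) + node i *\<^sub>R \<psi> (\<tau> i) (\<lambda>_. 1))" .

  have "\<psi> (\<lambda>_. 1) (\<lambda>t. t) = \<psi> (\<lambda>t. \<Sum>i<2 * n + 1. \<tau> i t) (\<lambda>t. t)"
    using partition by (intro local_left continuous_intros conts) simp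
  also have "\<dots> = (\<Sum>i<2 * n + 1. \<psi> (\<tau> i) (\<lambda>t. t))"
    by (intro sum_left continuous_intros conts) simp
  also have "\<dots> = (\<Sum>i<2 * n + 1. \<psi> (\<tau> i) (b i) + node i *\<^sub>R \<psi> (\<tau> i) (\<lambda>_. 1))"
  proof (rule sum.cong)
    fix i
    have "\<psi> (\<tau> i) (\<lambda>t. t) = \<psi> (\<tau> i) (\<lambda>t. b i t + node i * 1)"
      by (intro local_right continuous_intros conts b_eq)
    also have "\<dots> = \<psi> (\<tau> i) (b i) + \<psi> (\<tau> i) (\<lambda>_. node i * 1)"
      by (intro add_right continuous_intros conts)
    also have "\<psi> (\<tau> i) (\<lambda>_. node i * 1) = node i *\<^sub>R \<psi> (\<tau> i) (\<lambda>_. 1)"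
      by (intro scale_right continuous_intros conts)
    finally show "\<psi> (\<tau> i) (\<lambda>t. t) = \<psi> (\<tau> i) (b i) + node i *\<^sub>R \<psi> (\<tau> i) (\<lambda>_. 1)" .
  qed simp
  finally have "\<psi> (\<lambda>t. t) (\<lambda>_. 1) - \<psi> (\<lambda>_. 1) (\<lambda>t. t) =
      (\<Sum>i<2 * n + 1. \<psi> (a i) (\<kappa> i) - \<psi> (\<tau> i) (b i))"
    by (simp add: 1 sum_subtractf[symmetric])
  also have "\<dots> = (\<Sum>r<4. \<Sum>i\<in>{i \<in> {..<2 * n + 1}. i mod 4 = r}. \<psi> (a i) (\<kappa> i) - \<psi> (\<tau> i) (b i))"
    by (rule sum.group[symmetric]) auto
  also have "norm \<dots> \<le> (\<Sum>r::nat<4. 3 * K / n)"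
  proof (rule sum_norm_le)
    fix r :: nat
    define A where "A = {i \<in> {..<2 * n + 1}. i mod 4 = r}"
    have fin: "finite A" by (simp add: A_def)
    have far: "2 \<le> \<bar>u t - i\<bar> \<or> 2 \<le> \<bar>u t - j\<bar>" if "i \<in> A" "j \<in> A" "i \<noteq> j" for i j t
    proof -
      have "4 \<le> \<bar>int i - int j\<bar>" proof -
        have "int i mod 4 = int j mod 4"
          using that unfolding A_def by (metis (mono_tags, lifting) mem_Collect_eq of_nat_mod of_nat_numeral)
        then have "4 dvd int i - int j" by (simp add: mod_eq_dvd_iff)
        moreover have "int i - int j \<noteq> 0" using that by simp
        ultimately have "\<bar>4\<bar> \<le> \<bar>int i - int j\<bar>" by (rule dvd_imp_le_int[rotated])
        then show ?thesis by (simp only: abs_numeral)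
      qed
      then have "4 \<le> \<bar>real i - real j\<bar>" by linarith
      then show ?thesis by linarith
    qed
    have vanish: "a i t = 0 \<and> \<tau> i t = 0 \<and> \<kappa> i t = 0 \<and> b i t = 0 \<or>
        a j t = 0 \<and> \<tau> j t = 0 \<and> \<kappa> j t = 0 \<and> b j t = 0"
      if "i \<in> A" "j \<in> A" "i \<noteq> j" for i j t
      using far[OF that, of t] \<tau>0[of t i] \<tau>0[of t j] \<kappa>0[of t i] \<kappa>0[of t j]
      by (auto simp: a_def b_def)
    have "(\<Sum>i\<in>A. \<psi> (a i) (\<kappa> i)) = \<psi> (\<lambda>t. \<Sum>i\<in>A. a i t) (\<lambda>t. \<Sum>i\<in>A. \<kappa> i t)"
      by (rule sum_diagonal[OF fin]) (use conts vanish in blast)+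
    also have "norm \<dots> \<le> K * (1 / n) * 1"
    proof (rule bound)
      show "\<bar>\<Sum>i\<in>A. a i t\<bar> \<le> 1 / n" for t
        by (rule abs_sum_disjoint_le[OF fin]) (use a1 vanish in \<open>auto dest: vanish\<close>)+
      show "\<bar>\<Sum>i\<in>A. \<kappa> i t\<bar> \<le> 1" for t
        by (rule abs_sum_disjoint_le[OF fin]) (use \<kappa>1 vanish in \<open>auto dest: vanish\<close>)+
    qed (intro continuous_intros conts)+
    finally have 1: "norm (\<Sum>i\<in>A. \<psi> (a i) (\<kappa> i)) \<le> K / n" by simp
    have "(\<Sum>i\<in>A. \<psi> (\<tau> i) (b i)) = \<psi> (\<lambda>t. \<Sum>i\<in>A. \<tau> i t) (\<lambda>t. \<Sum>i\<in>A. b i t)"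
      by (rule sum_diagonal[OF fin]) (use conts vanish in blast)+
    also have "norm \<dots> \<le> K * 1 * (2 / n)"
    proof (rule bound)
      show "\<bar>\<Sum>i\<in>A. \<tau> i t\<bar> \<le> 1" for t
        by (rule abs_sum_disjoint_le[OF fin]) (use \<tau>1 vanish in \<open>auto dest: vanish\<close>)+
      show "\<bar>\<Sum>i\<in>A. b i t\<bar> \<le> 2 / n" for t
        by (rule abs_sum_disjoint_le[OF fin]) (use b1 vanish in \<open>auto dest: vanish\<close>)+
    qed (intro continuous_intros conts)+
    finally have 2: "norm (\<Sum>i\<in>A. \<psi> (\<tau> i) (b i)) \<le> 2 * K / n"
      by (simp add: mult.commute)
    have "norm (\<Sum>i\<in>A. \<psi> (a i) (\<kappa> i) - \<psi> (\<tau> i) (b i)) \<le> K / n + 2 * K / n"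
      using 1 2 unfolding sum_subtractf by (meson add_mono norm_triangle_ineq4 order_trans)
    then show "norm (\<Sum>i\<in>{i \<in> {..<2 * n + 1}. i mod 4 = r}. \<psi> (a i) (\<kappa> i) - \<psi> (\<tau> i) (b i)) \<le> 3 * K / n"
      by (simp add: A_def add_divide_distrib[symmetric])
  qed
  finally show ?thesis by simp
qed

theorem identity_commutes: "\<psi> (\<lambda>t. t) (\<lambda>_. 1) = \<psi> (\<lambda>_. 1) (\<lambda>t. t)"
proof -
  have "(\<lambda>n. 12 * K / real n) \<longlonglongrightarrow> 0"
    by (rule lim_const_over_n)
  then have "norm (\<psi> (\<lambda>t. t) (\<lambda>_. 1) - \<psi> (\<lambda>_. 1) (\<lambda>t. t)) \<le> 0"
    by (rule tendsto_lowerbound)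
      (use norm_commutation_defect in \<open>auto simp: eventually_sequentially intro!: exI[of _ 1]\<close>)
  then show ?thesis by simp
qed

end

section \<open>Continuous functional calculus\<close>

lemma poly_fun_eq:
  "poly (p + q) = (\<lambda>t. poly p t + poly q t)" "poly (p * q) = (\<lambda>t. poly p t * poly q t)"
  "poly (smult c p) = (\<lambda>t. c * poly p t)"
  by auto

lemma exists_uniform_poly_limit:
  assumes "cont f"
  obtains P where "uniform_limit {-1..1} (\<lambda>n. poly (P n)) f sequentially"
proof -
  have "\<exists>p. \<forall>t\<in>{-1..1}. \<bar>f t - poly p t\<bar> < 1 / Suc n" for n
  proof -
    obtain g where g: "real_polynomial_function g" "\<And>t. t \<in> {-1..1} \<Longrightarrow> \<bar>f t - g t\<bar> < 1 / Suc n"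
      by (rule Stone_Weierstrass_real_polynomial_function[OF _ assms, of "1 / Suc n"]) auto
    then obtain a m where "g = (\<lambda>x. \<Sum>i\<le>m. a i * x ^ i)"
      unfolding real_polynomial_function_iff_sum by blast
    then have "poly (\<Sum>i\<le>m. Polynomial.monom (a i) i) = g"
      by (auto simp: poly_sum poly_monom)
    with g(2) show ?thesis by metis
  qed
  then obtain P where P: "\<And>n t. t \<in> {-1..1} \<Longrightarrow> \<bar>f t - poly (P n) t\<bar> < 1 / Suc n"
    by metis
  have "uniform_limit {-1..1} (\<lambda>n. poly (P n)) f sequentially"
  proof (rule uniform_limitI)
    fix e :: real assume "0 < e"
    then obtain N where "1 / Suc N < e" using nat_approx_posE by blast
    then have "1 / Suc n < e" if "N \<le> n" for n
      using that by (smt (verit) frac_le of_nat_0_less_iff of_nat_le_iff zero_less_Suc Suc_le_mono)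
    then show "\<forall>\<^sub>F n in sequentially. \<forall>t\<in>{-1..1}. dist (poly (P n) t) (f t) < e"
      unfolding eventually_sequentially dist_real_def
      by (metis P abs_minus_commute order_less_trans)
  qed
  with that show ?thesis by blast
qed

context sine
begin

text \<open>
  The element \<open>f(s)y\<close>, as the common limit over all uniform polynomial approximations of \<open>f\<close>. It is
  only meaningful if there are such approximations.
\<close>

definition cfc :: "(real \<Rightarrow> real) \<Rightarrow> 'a \<Rightarrow> 'a"
  where "cfc f y = (THE l. \<forall>P. uniform_limit {-1..1} (\<lambda>n. poly (P n)) f sequentially \<longrightarrow>
    (\<lambda>n. poly_action s (P n) y) \<longlonglongrightarrow> l)"

lemma norm_poly_action_diff_small:
  assumes P: "uniform_limit {-1..1} (\<lambda>n. poly (P n)) f sequentially"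
    and Q: "uniform_limit {-1..1} (\<lambda>n. poly (Q n)) f sequentially" and e: "0 < e"
  shows "\<exists>N. \<forall>m\<ge>N. \<forall>n\<ge>N. norm (poly_action s (P m) y - poly_action s (Q n) y) < e"
proof -
  define d where "d = e / (2 * (norm y + 1))"
  have d: "0 < d" using e by (simp add: d_def add_nonneg_pos)
  obtain N where "\<forall>n\<ge>N. (\<forall>t\<in>{-1..1}. \<bar>poly (P n) t - f t\<bar> < d) \<and> (\<forall>t\<in>{-1..1}. \<bar>poly (Q n) t - f t\<bar> < d)"
    using eventually_conj[OF uniform_limitD[OF P d] uniform_limitD[OF Q d]]
    unfolding eventually_sequentially dist_real_def by blast
  then have N: "\<And>n t. N \<le> n \<Longrightarrow> \<bar>t\<bar> \<le> 1 \<Longrightarrow> \<bar>poly (P n) t - f t\<bar> < d"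
    "\<And>n t. N \<le> n \<Longrightarrow> \<bar>t\<bar> \<le> 1 \<Longrightarrow> \<bar>poly (Q n) t - f t\<bar> < d"
    by (auto simp: abs_le_iff)
  have "norm (poly_action s (P m) y - poly_action s (Q n) y) < e" if "N \<le> m" "N \<le> n" for m n
  proof -
    have "norm (poly_action s (P m - Q n) y) \<le> (2 * d) * norm y"
    proof (rule norm_poly_action)
      show "\<bar>poly (P m - Q n) t\<bar> \<le> 2 * d" if "\<bar>t\<bar> \<le> 1" for t
        using N(1)[OF \<open>N \<le> m\<close> that] N(2)[OF \<open>N \<le> n\<close> that] by simp
    qed
    also have "\<dots> < (2 * d) * (norm y + 1)" using d by simp
    also have "\<dots> = e"
    proof -
      have "2 * (e / (2 * r)) * r = e" if "r \<noteq> 0" for r using that by simp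
      moreover have "norm y + 1 \<noteq> 0" using norm_ge_zero[of y] by linarith
      ultimately show ?thesis unfolding d_def by blast
    qed
    finally show ?thesis by (simp add: poly_action_diff)
  qed
  then show ?thesis by blast
qed

lemma cfc_tendsto:
  assumes P: "uniform_limit {-1..1} (\<lambda>n. poly (P n)) f sequentially"
  shows "(\<lambda>n. poly_action s (P n) y) \<longlonglongrightarrow> cfc f y"
proof -
  have "Cauchy (\<lambda>n. poly_action s (P n) y)"
    by (rule CauchyI) (rule norm_poly_action_diff_small[OF P P])
  then obtain l where l: "(\<lambda>n. poly_action s (P n) y) \<longlonglongrightarrow> l"
    using Cauchy_convergent convergent_def by blast
  have all: "(\<lambda>n. poly_action s (Q n) y) \<longlonglongrightarrow> l"
    if Q: "uniform_limit {-1..1} (\<lambda>n. poly (Q n)) f sequentially" for Q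
  proof -
    have "(\<lambda>n. poly_action s (Q n) y - poly_action s (P n) y) \<longlonglongrightarrow> 0"
      by (rule LIMSEQ_I) (use norm_poly_action_diff_small[OF Q P] in fastforce)
    from tendsto_add[OF this l] show ?thesis by simp
  qed
  have "cfc f y = l"
    unfolding cfc_def by (rule the_equality) (use all P l LIMSEQ_unique in blast)+
  with l show ?thesis by simp
qed

lemma cfc_poly: "cfc (poly p) y = poly_action s p y"
  using cfc_tendsto[of "\<lambda>_. p" "poly p"] LIMSEQ_unique tendsto_const
  by (fastforce intro: uniform_limit_const)

lemma cfc_identity: "cfc (\<lambda>t. t) y = s * y"
proof -
  have "(\<lambda>t. t) = poly [:0, 1 :: real:]" by auto
  then show ?thesis by (simp add: cfc_poly)
qed

lemma cfc_one: "cfc (\<lambda>_. 1) y = y"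
proof -
  have "(\<lambda>_. 1) = poly (1 :: real poly)" by auto
  then show ?thesis by (simp add: cfc_poly)
qed

lemma cfc_add:
  assumes "cont f" "cont g"
  shows "cfc (\<lambda>t. f t + g t) y = cfc f y + cfc g y"
proof -
  obtain P Q where P: "uniform_limit {-1..1} (\<lambda>n. poly (P n)) f sequentially"
    and Q: "uniform_limit {-1..1} (\<lambda>n. poly (Q n)) g sequentially"
    using assms exists_uniform_poly_limit by metis
  have "uniform_limit {-1..1} (\<lambda>n. poly (P n + Q n)) (\<lambda>t. f t + g t) sequentially"
    using uniform_limit_add[OF P Q] by (simp add: poly_fun_eq)
  from LIMSEQ_unique[OF cfc_tendsto[OF this, of y]]
  show ?thesis
    using tendsto_add[OF cfc_tendsto[OF P, of y] cfc_tendsto[OF Q, of y]]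
    by (simp add: poly_action_add)
qed

lemma cfc_scale:
  assumes "cont f"
  shows "cfc (\<lambda>t. c * f t) y = c *\<^sub>R cfc f y"
proof -
  obtain P where P: "uniform_limit {-1..1} (\<lambda>n. poly (P n)) f sequentially"
    using assms exists_uniform_poly_limit by metis
  have "uniform_limit {-1..1} (\<lambda>n. poly (smult c (P n))) (\<lambda>t. c * f t) sequentially"
    using bounded_linear.uniform_limit[OF bounded_linear_mult_right P, of c] by (simp add: poly_fun_eq)
  from LIMSEQ_unique[OF cfc_tendsto[OF this, of y]]
  show ?thesis
    using tendsto_scaleR[OF tendsto_const cfc_tendsto[OF P, of y], of c]
    by (simp add: poly_action_smult)
qed

lemma norm_cfc:
  assumes f: "cont f" and M: "\<And>t. \<bar>t\<bar> \<le> 1 \<Longrightarrow> \<bar>f t\<bar> \<le> M"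
  shows "norm (cfc f y) \<le> M * norm y"
proof -
  obtain P where P: "uniform_limit {-1..1} (\<lambda>n. poly (P n)) f sequentially"
    using f exists_uniform_poly_limit by metis
  have le: "norm (cfc f y) \<le> (M + e) * norm y" if e: "0 < e" for e
  proof (rule tendsto_upperbound[OF tendsto_norm[OF cfc_tendsto[OF P, of y]]])
    show "\<forall>\<^sub>F n in sequentially. norm (poly_action s (P n) y) \<le> (M + e) * norm y"
      using uniform_limitD[OF P e]
    proof eventually_elim
      case (elim n)
      show ?case
      proof (rule norm_poly_action)
        fix t :: real assume t: "\<bar>t\<bar> \<le> 1"
        then have "\<bar>poly (P n) t - f t\<bar> < e" using elim by (auto simp: dist_real_def abs_le_iff)
        with M[OF t] show "\<bar>poly (P n) t\<bar> \<le> M + e" by linarith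
      qed
    qed
  qed simp
  have "((\<lambda>e. (M + e) * norm y) \<longlongrightarrow> (M + 0) * norm y) (at_right 0)"
    by (intro tendsto_intros)
  then have "norm (cfc f y) \<le> (M + 0) * norm y"
    by (rule tendsto_lowerbound) (auto simp: eventually_at_filter le)
  then show ?thesis by simp
qed

text \<open>
  Since \<open>s\<close> is self-adjoint, the left factor is \<open>x\<^sup>*\<close> times \<open>f(s)\<close>. In particular functions with
  \<open>fg = 0\<close> produce elements of the algebra with product zero.
\<close>

lemma star_cfc_mult_cfc:
  assumes "cont f" "cont g"
  shows "star (cfc f x) * cfc g y = star x * cfc (\<lambda>t. f t * g t) y"
proof -
  obtain P Q where P: "uniform_limit {-1..1} (\<lambda>n. poly (P n)) f sequentially"
    and Q: "uniform_limit {-1..1} (\<lambda>n. poly (Q n)) g sequentially"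
    using assms exists_uniform_poly_limit by metis
  have "bounded (f ` {-1..1})" "bounded (g ` {-1..1})"
    using assms compact_continuous_image compact_imp_bounded by blast+
  then have "uniform_limit {-1..1} (\<lambda>n. poly (P n * Q n)) (\<lambda>t. f t * g t) sequentially"
    using uniform_lim_mult[OF P Q] by (simp add: poly_fun_eq)
  then have "(\<lambda>n. star x * poly_action s (P n * Q n) y) \<longlonglongrightarrow> star x * cfc (\<lambda>t. f t * g t) y"
    by (intro tendsto_intros cfc_tendsto)
  moreover have "(\<lambda>n. star (poly_action s (P n) x) * poly_action s (Q n) y)
      \<longlonglongrightarrow> star (cfc f x) * cfc g y"
    by (intro tendsto_intros bounded_linear.tendsto[OF bounded_linear_star] cfc_tendsto P Q)
  ultimately show ?thesis
    using LIMSEQ_unique by (simp add: poly_action_symmetric[OF star_s] poly_action_mult)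
qed

end

section \<open>Bilinear maps that vanish on zero products\<close>

locale zero_product_form = bounded_bilinear \<phi>
  for \<phi> :: "'a::cstar_algebra \<Rightarrow> 'a \<Rightarrow> 'v::real_normed_vector" +
  assumes scaleC_middle: "\<phi> (c *\<^sub>C a) b = \<phi> a (c *\<^sub>C b)"
    and zero_product: "a * b = 0 \<Longrightarrow> \<phi> a b = 0"
begin

text \<open>
  The bilinear form \<open>\<psi>(f, g) = \<phi>(x f(s), g(s) y)\<close> is bounded for the maximum norm and vanishes for
  functions with product zero. The right multiplication \<open>x f(s)\<close> is written as \<open>(f(s) x\<^sup>*)\<^sup>*\<close>.
\<close>

lemma balanced_sine:
  assumes "sine h s"
  shows "\<phi> (x * s) y = \<phi> x (s * y)"
proof -
  interpret sine h s by fact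
  obtain K where K: "0 < K" "\<And>a b. norm (\<phi> a b) \<le> norm a * norm b * K"
    using pos_bounded by blast
  interpret disjointness_form "\<lambda>f g. \<phi> (star (cfc f (star x))) (cfc g y)" "K * norm x * norm y"
  proof
    fix f g :: "real \<Rightarrow> real" assume fg: "cont f" "cont g"
    show "norm (\<phi> (star (cfc f (star x))) (cfc g y)) \<le> K * norm x * norm y * M * N"
      if "\<And>t. \<bar>t\<bar> \<le> 1 \<Longrightarrow> \<bar>f t\<bar> \<le> M" "\<And>t. \<bar>t\<bar> \<le> 1 \<Longrightarrow> \<bar>g t\<bar> \<le> N" for M N
    proof -
      have "norm (\<phi> (star (cfc f (star x))) (cfc g y)) \<le> norm (cfc f (star x)) * norm (cfc g y) * K"
        using K(2)[of "star (cfc f (star x))" "cfc g y"] by (simp add: norm_star)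
      also have "\<dots> \<le> (M * norm x) * (N * norm y) * K"
        using norm_cfc[OF fg(1) that(1), of "star x"] norm_cfc[OF fg(2) that(2), of y] K(1)
          that(1)[of 0]
        by (intro mult_right_mono mult_mono) (auto simp: norm_star)
      finally show ?thesis by (simp add: algebra_simps)
    qed
    show "\<phi> (star (cfc f (star x))) (cfc g y) = 0" if "\<And>t. \<bar>t\<bar> \<le> 1 \<Longrightarrow> f t = 0 \<or> g t = 0"
    proof (rule zero_product)
      have "norm (cfc (\<lambda>t. f t * g t) y) \<le> 0 * norm y"
        by (rule norm_cfc) (use fg that in \<open>auto intro!: continuous_intros\<close>)
      then show "star (cfc f (star x)) * cfc g y = 0"
        by (simp add: star_cfc_mult_cfc fg)
    qed
  qed (simp_all add: cfc_add cfc_scale star_simps add_left add_right scaleR_left scaleR_right)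
  show ?thesis
    using identity_commutes by (simp add: cfc_one cfc_identity star_simps star_s)
qed

text \<open>
  Put \<open>x(1 + t\<^sup>2h\<^sup>2)\<close> and \<open>(1 + t\<^sup>2h\<^sup>2)y\<close> in place of \<open>x\<close> and \<open>y\<close> in the identity for
  \<open>s = 2th / (1 + t\<^sup>2h\<^sup>2)\<close>. The denominators cancel, and the required identity appears as the term of
  lowest order in \<open>t\<close>.
\<close>

lemma balanced_self_adjoint:
  assumes h: "star h = h"
  shows "\<phi> (x * h) y = \<phi> x (h * y)"
proof -
  define p where "p = \<phi> (x * h) y - \<phi> x (h * y)"
  define q where "q = \<phi> (x * h * h) (h * y) - \<phi> (x * h) (h * h * y)"
  have eq: "p = t\<^sup>2 *\<^sub>R q" if t: "0 < t" "t * norm h < 1" for t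
  proof -
    obtain s where s: "star s = s" "s + (t *\<^sub>R h) * (t *\<^sub>R h) * s = 2 *\<^sub>R (t *\<^sub>R h)"
      "(t *\<^sub>R h) * s = s * (t *\<^sub>R h)"
      using sine_of_self_adjoint[of "t *\<^sub>R h"] h t by (auto simp: star_scaleR)
    then interpret sine "t *\<^sub>R h" s
      by unfold_locales (simp_all add: star_scaleR h)
    have comm': "h * s = s * h" using comm t by simp
    have 1: "s + t\<^sup>2 *\<^sub>R (h * h * s) = (2 * t) *\<^sub>R h"
      using sine_eq by (simp add: power2_eq_square)
    have 2: "s + t\<^sup>2 *\<^sub>R (s * h * h) = (2 * t) *\<^sub>R h"
      using 1 comm' by (metis mult.assoc)
    have left: "(x + t\<^sup>2 *\<^sub>R (x * h * h)) * s = (2 * t) *\<^sub>R (x * h)"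
      using arg_cong[OF 1, of "\<lambda>z. x * z"] by (simp add: algebra_simps)
    have right: "s * (y + t\<^sup>2 *\<^sub>R (h * h * y)) = (2 * t) *\<^sub>R (h * y)"
      using arg_cong[OF 2, of "\<lambda>z. z * y"] by (simp add: algebra_simps)
    have "\<phi> ((2 * t) *\<^sub>R (x * h)) (y + t\<^sup>2 *\<^sub>R (h * h * y)) =
        \<phi> (x + t\<^sup>2 *\<^sub>R (x * h * h)) ((2 * t) *\<^sub>R (h * y))"
      using balanced_sine[OF sine_axioms, of "x + t\<^sup>2 *\<^sub>R (x * h * h)" "y + t\<^sup>2 *\<^sub>R (h * h * y)"]
      unfolding left right .
    then have "(2 * t) *\<^sub>R (\<phi> (x * h) y + t\<^sup>2 *\<^sub>R \<phi> (x * h) (h * h * y)) =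
        (2 * t) *\<^sub>R (\<phi> x (h * y) + t\<^sup>2 *\<^sub>R \<phi> (x * h * h) (h * y))"
      by (simp add: add_left add_right scaleR_left scaleR_right scaleR_add_right mult.commute mult.left_commute)
    then have "\<phi> (x * h) y + t\<^sup>2 *\<^sub>R \<phi> (x * h) (h * h * y) =
        \<phi> x (h * y) + t\<^sup>2 *\<^sub>R \<phi> (x * h * h) (h * y)"
      using t by simp
    then show ?thesis by (simp add: p_def q_def algebra_simps)
  qed
  have "p = (inverse (real n + 1 + norm h))\<^sup>2 *\<^sub>R q" for n
    by (rule eq) (auto simp: field_simps add_pos_nonneg)
  moreover have "(\<lambda>n. (inverse (real n + 1 + norm h))\<^sup>2 *\<^sub>R q) \<longlonglongrightarrow> 0\<^sup>2 *\<^sub>R q"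
  proof (intro tendsto_intros tendsto_inverse_0_at_top)
    show "filterlim (\<lambda>n. real n + 1 + norm h) at_top sequentially"
      using filterlim_tendsto_add_at_top[OF tendsto_const[of "1 + norm h"] filterlim_real_sequentially]
      by (simp add: algebra_simps)
  qed
  ultimately have "p = 0"
    using LIMSEQ_unique[OF tendsto_const[of p]] by simp
  then show ?thesis by (simp add: p_def)
qed

theorem balanced: "\<phi> (a * b) c = \<phi> a (b * c)"
proof -
  define b1 where "b1 = (1 / 2) *\<^sub>R (b + star b)"
  define b2 where "b2 = (1 / 2) *\<^sub>R (\<i> *\<^sub>C (star b - b))"
  have sa: "star b1 = b1" "star b2 = b2"
    by (simp_all add: b1_def b2_def star_simps scaleC_minus_left scaleC_diff_right algebra_simps)
  have b: "b = b1 + \<i> *\<^sub>C b2"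
  proof -
    have "\<i> *\<^sub>C b2 = (1 / 2) *\<^sub>R (b - star b)"
    proof -
      have "\<i> *\<^sub>C b2 = (1 / 2) *\<^sub>R (\<i> *\<^sub>C \<i> *\<^sub>C (star b - b))"
        by (simp only: b2_def scaleR_scaleC scaleC_scaleC mult.commute[of "\<i> * \<i>"] mult.left_commute mult.assoc mult.commute)
      then show ?thesis by (simp add: scaleC_i_i)
    qed
    then have "b1 + \<i> *\<^sub>C b2 = (1 / 2) *\<^sub>R (b + star b + (b - star b))"
      by (simp only: b1_def scaleR_add_right)
    also have "\<dots> = b" by (simp add: scaleR_2[symmetric])
    finally show ?thesis by simp
  qed
  have "\<phi> (a * b) c = \<phi> (a * b1) c + \<phi> ((\<i> *\<^sub>C a) * b2) c"
    by (simp add: b distrib_left add_left mult_scaleC_left mult_scaleC_right)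
  also have "\<dots> = \<phi> a (b1 * c) + \<phi> (\<i> *\<^sub>C a) (b2 * c)"
    by (simp only: balanced_self_adjoint[OF sa(1)] balanced_self_adjoint[OF sa(2)])
  also have "\<dots> = \<phi> a (b * c)"
    by (simp add: b distrib_right add_right scaleC_middle mult_scaleC_left)
  finally show ?thesis .
qed

end

section \<open>Approximate units\<close>

text \<open>
  With \<open>v = t\<^sup>2\<close>, Bernoulli's inequality gives \<open>(1 - v)\<^sup>n (1 + nv) \<le> (1 - v\<^sup>2)\<^sup>n \<le> 1\<close>.
\<close>

lemma exists_damping_power:
  assumes "0 < \<delta>"
  shows "\<exists>n. \<forall>t::real. \<bar>t\<bar> \<le> 1 \<longrightarrow> \<bar>t * (1 - t\<^sup>2) ^ n\<bar> \<le> \<delta>"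
proof -
  obtain n :: nat where n: "1 / \<delta>\<^sup>2 < n" using reals_Archimedean2 by blast
  have "\<bar>t * (1 - t\<^sup>2) ^ n\<bar> \<le> \<delta>" if t: "\<bar>t\<bar> \<le> 1" for t :: real
  proof -
    define v where "v = t\<^sup>2"
    have v: "0 \<le> v" "v \<le> 1" using t by (auto simp: v_def abs_square_le_1)
    have "(1 - v) ^ n * (1 + n * v) \<le> (1 - v) ^ n * (1 + v) ^ n"
      using v Bernoulli_inequality[of v n] by (intro mult_left_mono) auto
    also have "\<dots> = (1 - v\<^sup>2) ^ n" by (simp add: power_mult_distrib[symmetric] power2_eq_square algebra_simps)
    also have "\<dots> \<le> 1" using v by (intro power_le_one) (auto simp: power_le_one)
    finally have "n * (v * (1 - v) ^ n) \<le> 1"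
      using v by (simp add: algebra_simps) (smt (verit) zero_le_power)
    moreover have "n * (v * ((1 - v) ^ n)\<^sup>2) \<le> n * (v * (1 - v) ^ n)"
      using v by (intro mult_left_mono) (auto simp: power2_eq_square mult_left_le power_le_one)
    ultimately have "n * (t * (1 - t\<^sup>2) ^ n)\<^sup>2 \<le> 1" by (simp add: v_def power_mult_distrib)
    also have "1 \<le> n * \<delta>\<^sup>2" using n assms by (simp add: field_simps)
    finally have "(t * (1 - t\<^sup>2) ^ n)\<^sup>2 \<le> \<delta>\<^sup>2"
      using n assms by (smt (verit) divide_nonneg_nonneg mult_le_cancel_left_pos zero_le_power2)
    then show ?thesis using assms by (simp add: abs_le_square_iff[symmetric])
  qed
  then show ?thesis by blast
qed

lemma star_poly_action_self:
  assumes "star s = s"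
  shows "star (poly_action s p s) = poly_action s p s"
proof (induction p)
  case (pCons a p)
  have "poly_action s p s * s = s * poly_action s p s"
    by (metis poly_action_commute poly_action_mult_right)
  with pCons show ?case by (simp add: star_simps assms)
qed (simp add: star_zero)

text \<open>
  Take \<open>e = 1 - (1 - s\<^sup>2)\<^sup>n\<close> where \<open>s\<close> belongs to a small multiple \<open>h\<close> of \<open>xx\<^sup>*\<close>. The factor
  \<open>(1 - s\<^sup>2)\<^sup>n\<close> is a contraction that nearly annihilates \<open>s\<close>, hence \<open>h\<^sup>2\<close>, and by the C*-identity
  also \<open>h\<close> and \<open>x\<close>. The factorization of \<open>e\<close> through \<open>xx\<^sup>*\<close> keeps \<open>e\<close> in every ideal
  that contains \<open>x\<close>, and shows that \<open>x\<close> is in the closure of \<open>xx\<^sup>*A\<close>.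
\<close>

lemma approximate_unit_single:
  fixes x :: "'a::cstar_algebra"
  assumes \<eta>: "0 < \<eta>"
  obtains c e where "e = x * star x * c" "star e = e" "norm (x - e * x) \<le> \<eta>"
    "\<And>y. norm (y - e * y) \<le> norm y"
proof -
  define t where "t = inverse ((norm x)\<^sup>2 + 1)"
  have t: "0 < t" unfolding t_def by (simp add: add_nonneg_pos)
  define h where "h = t *\<^sub>R (x * star x)"
  have sh: "star h = h" by (simp add: h_def star_simps)
  have nh: "norm h < 1"
    using t by (simp add: h_def cstar_identity') (simp add: t_def field_simps add_nonneg_pos)
  obtain s where "star s = s" "s + h * h * s = 2 *\<^sub>R h" "h * s = s * h"
    using sine_of_self_adjoint[OF sh nh] by blast
  then interpret sine h s by unfold_locales (rule sh)
  define C where "C = norm (h + h * h * h)"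
  \<comment> \<open>The estimates below bound the fourth power of the error by \<open>\<delta>C/t\<^sup>2\<close>.\<close>
  define \<delta> where "\<delta> = \<eta> ^ 4 * t\<^sup>2 / (C + 1)"
  have \<delta>: "0 < \<delta>"
    unfolding \<delta>_def C_def using \<eta> t by (intro divide_pos_pos mult_pos_pos zero_less_power add_nonneg_pos) auto
  obtain n where n: "\<And>u::real. \<bar>u\<bar> \<le> 1 \<Longrightarrow> \<bar>u * (1 - u\<^sup>2) ^ n\<bar> \<le> \<delta>"
    using exists_damping_power[OF \<delta>] by blast
  define X :: "real poly" where "X = [:0, 1:]"
  define q where "q = (1 - X\<^sup>2) ^ n"
  have X: "poly X u = u" "poly_action s X y = s * y" for u y by (simp_all add: X_def)
  have pq: "poly q u = (1 - u\<^sup>2) ^ n" for u by (simp add: q_def X poly_power)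
  have "X\<^sup>2 dvd 1 - q"
    unfolding q_def
  proof (induction n)
    case (Suc n)
    have "1 - (1 - X\<^sup>2) ^ Suc n = (1 - (1 - X\<^sup>2) ^ n) + X\<^sup>2 * (1 - X\<^sup>2) ^ n"
      by (simp add: algebra_simps)
    with Suc show ?case by (metis dvd_add dvd_triv_left)
  qed simp
  then obtain r where r: "1 - q = X * X * r" by (auto simp: power2_eq_square dvd_def)
  define c0 where "c0 = poly_action s r s"
  define e where "e = s * c0"
  define c where "c = t *\<^sub>R (2 *\<^sub>R c0 - h * s * c0)"
  have "s = 2 *\<^sub>R h - h * h * s" using sine_eq by (metis add_diff_cancel_right')
  then have "e = (2 *\<^sub>R h - h * h * s) * c0" unfolding e_def by (rule arg_cong)
  also have "\<dots> = h * (2 *\<^sub>R c0 - h * s * c0)" by (simp add: algebra_simps)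
  finally have "e = h * (2 *\<^sub>R c0 - h * s * c0)" .
  then have ec: "e = x * star x * c" by (simp add: h_def c_def)
  have e_poly: "e = poly_action s (X * r) s"
    by (simp add: e_def c0_def poly_action_mult X)
  have se: "star e = e" unfolding e_poly by (rule star_poly_action_self[OF star_s])
  have ey: "y - e * y = poly_action s q y" for y
  proof -
    have "e * y = poly_action s (X * r * X) y"
      by (simp add: e_poly poly_action_mult X poly_action_mult_right)
    also have "X * r * X = 1 - q" by (simp add: r mult_ac)
    finally show ?thesis by (simp add: poly_action_diff)
  qed
  have contr: "norm (poly_action s q y) \<le> norm y" for y
  proof -
    have "norm (poly_action s q y) \<le> 1 * norm y"
    proof (rule norm_poly_action)
      fix u :: real assume "\<bar>u\<bar> \<le> 1"
      then have "0 \<le> 1 - u\<^sup>2" by (simp add: abs_square_le_1)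
      then show "\<bar>poly q u\<bar> \<le> 1" by (simp add: pq power_abs[symmetric] power_le_one)
    qed
    then show ?thesis by simp
  qed
  have square: "(norm (poly_action s q y))\<^sup>2 \<le> norm (poly_action s q (y * star y))" for y
  proof -
    have "(norm (poly_action s q y))\<^sup>2 = norm (poly_action s q (y * star (poly_action s q y)))"
      by (simp add: cstar_identity'[symmetric] poly_action_mult_right)
    also have "\<dots> \<le> norm (star (y * star (poly_action s q y)))"
      by (simp add: contr norm_star)
    also have "star (y * star (poly_action s q y)) = poly_action s q (y * star y)"
      by (simp add: star_simps poly_action_mult_right)
    finally show ?thesis .
  qed
  have hh: "norm (poly_action s q (h * h)) \<le> \<delta> * C"
  proof -
    have "2 *\<^sub>R (h * h) = (s + h * h * s) * h" by (simp add: sine_eq)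
    also have "\<dots> = s * (h + h * h * h)"
      using comm by (simp add: distrib_left distrib_right mult.assoc) (metis mult.assoc)
    finally have "2 *\<^sub>R poly_action s q (h * h) = poly_action s (q * X) (h + h * h * h)"
      by (simp add: poly_action_mult X flip: poly_action_scaleR_right)
    also have "norm \<dots> \<le> \<delta> * C"
      unfolding C_def
    proof (rule norm_poly_action)
      show "\<bar>poly (q * X) u\<bar> \<le> \<delta>" if "\<bar>u\<bar> \<le> 1" for u
        using n[OF that] by (simp add: pq X mult.commute)
    qed
    finally have "2 * norm (poly_action s q (h * h)) \<le> \<delta> * C" by simp
    then show ?thesis using norm_ge_zero[of "poly_action s q (h * h)"] by linarith
  qed
  have "(norm (poly_action s q x))\<^sup>2 \<le> norm (poly_action s q (x * star x))" by (rule square)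
  also have "\<dots> = norm (poly_action s q h) / t"
    using t by (simp add: h_def poly_action_scaleR_right)
  finally have "((norm (poly_action s q x))\<^sup>2)\<^sup>2 \<le> (norm (poly_action s q h) / t)\<^sup>2"
    by (rule power_mono) simp
  also have "\<dots> \<le> \<delta> * C / t\<^sup>2"
    using square[of h] hh by (simp add: sh power_divide divide_right_mono)
  also have "\<dots> \<le> \<eta> ^ 4"
  proof -
    have "C / (C + 1) \<le> 1" by (simp add: C_def add_nonneg_pos)
    then have "\<eta> ^ 4 * (C / (C + 1)) \<le> \<eta> ^ 4 * 1" using \<eta> by (intro mult_left_mono) auto
    then show ?thesis using t by (simp add: \<delta>_def)
  qed
  finally have "norm (poly_action s q x) ^ 4 \<le> \<eta> ^ 4" by simp
  then have "norm (poly_action s q x) \<le> \<eta>"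
    using \<eta> by (simp add: power_mono_iff)
  with ec se ey contr that show ?thesis by metis
qed

text \<open>
  Elements are treated one after another by multiplying the contractions \<open>1 - e\<close>; those for later
  elements do not enlarge the earlier errors.
\<close>

lemma left_approximate_unit:
  fixes F :: "'a::cstar_algebra set"
  assumes "finite F" "0 < \<eta>"
  shows "\<exists>e. (\<forall>x\<in>F. norm (x - e * x) \<le> \<eta>) \<and> (\<forall>y. norm (y - e * y) \<le> norm y)"
  using assms(1)
proof (induction F)
  case empty
  show ?case by (rule exI[of _ 0]) simp
next
  case (insert x F)
  then obtain e where e: "\<And>x. x \<in> F \<Longrightarrow> norm (x - e * x) \<le> \<eta>" "\<And>y. norm (y - e * y) \<le> norm y"
    by blast
  obtain d where d: "norm ((x - e * x) - d * (x - e * x)) \<le> \<eta>" "\<And>y. norm (y - d * y) \<le> norm y"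
    using approximate_unit_single[OF assms(2), of "x - e * x"] by metis
  have eq: "y - (e + d - d * e) * y = (y - e * y) - d * (y - e * y)" for y
    by (simp add: algebra_simps)
  show ?case
  proof (intro exI[of _ "e + d - d * e"] conjI ballI allI)
    show "norm (y - (e + d - d * e) * y) \<le> norm y" for y
      unfolding eq using d(2) e(2) order_trans by blast
    show "norm (y - (e + d - d * e) * y) \<le> \<eta>" if "y \<in> insert x F" for y
      unfolding eq using d e(1)[of y] that order_trans by blast
  qed
qed

text \<open>
  If \<open>d\<close> is a left approximate unit for a self-adjoint set, then the element \<open>e\<close> with
  \<open>1 - e = (1 - d)\<^sup>*(1 - d)\<close> is self-adjoint and works on both sides.
\<close>

lemma approximate_unit:
  fixes F :: "'a::cstar_algebra set"
  assumes F: "finite F" and \<eta>: "0 < \<eta>"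
  obtains e where "norm e \<le> 2" "\<And>x. x \<in> F \<Longrightarrow> norm (x - e * x) \<le> \<eta>"
    "\<And>x. x \<in> F \<Longrightarrow> norm (x - x * e) \<le> \<eta>"
proof -
  obtain d where d: "\<And>x. x \<in> F \<union> star ` F \<Longrightarrow> norm (x - d * x) \<le> \<eta>"
    and contr: "\<And>y. norm (y - d * y) \<le> norm y"
    using left_approximate_unit[of "F \<union> star ` F", OF _ \<eta>] F by auto
  have contr': "norm (y - star d * y) \<le> norm y" for y
  proof -
    define w where "w = y - star d * y"
    have "(norm w)\<^sup>2 = norm (star y * (w - d * w))"
      by (simp add: cstar_identity[symmetric]) (simp add: w_def star_simps algebra_simps)
    also have "\<dots> \<le> norm y * norm w"
      by (metis contr mult_left_mono norm_ge_zero norm_mult_ineq norm_star order_trans)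
    finally show ?thesis unfolding w_def[symmetric]
      by (cases "w = 0") (auto simp: power2_eq_square)
  qed
  define e where "e = d + star d - star d * d"
  have left: "y - e * y = (y - d * y) - star d * (y - d * y)" for y
    by (simp add: e_def algebra_simps)
  have se: "star e = e" by (simp add: e_def star_simps add.commute)
  have le: "norm (x - e * x) \<le> \<eta>" if "x \<in> F \<union> star ` F" for x
    unfolding left using contr' d[OF that] order_trans by blast
  have "norm (x - x * e) \<le> \<eta>" if "x \<in> F" for x
  proof -
    have "norm (x - x * e) = norm (star (x - x * e))" by (simp add: norm_star)
    also have "\<dots> = norm (star x - e * star x)" by (simp add: star_simps se)
    also have "\<dots> \<le> \<eta>" using that by (intro le) auto
    finally show ?thesis .
  qed
  moreover have "norm e \<le> 2"
  proof -
    have "norm (e - e * e) \<le> norm e" unfolding left using contr' contr order_trans by blast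
    then have "norm (e * e) \<le> 2 * norm e"
      using norm_triangle_ineq2[of "e * e" e] by (simp add: norm_minus_commute)
    then have "norm e * norm e \<le> 2 * norm e"
      using cstar_identity[of e] by (simp add: se power2_eq_square)
    then show ?thesis by (cases "e = 0") auto
  qed
  ultimately show ?thesis using that le by blast
qed

lemma in_closure_mult:
  fixes x :: "'a::cstar_algebra"
  obtains c where "(\<lambda>n. x * star x * c n) \<longlonglongrightarrow> x"
proof -
  have "\<exists>c. norm (x - x * star x * c) \<le> 1 / Suc n" for n
    using approximate_unit_single[of "1 / Suc n" x] by (metis mult.assoc of_nat_0_less_iff zero_less_Suc zero_less_divide_1_iff)
  then obtain c where c: "\<And>n. norm (x - x * star x * c n) \<le> 1 / Suc n" by metis
  have "(\<lambda>n. x * star x * c n - x) \<longlonglongrightarrow> 0"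
    by (rule Lim_null_comparison[OF _ LIMSEQ_Suc[OF lim_1_over_n]])
      (use c in \<open>simp add: norm_minus_commute\<close>)
  then have "(\<lambda>n. x * star x * c n) \<longlonglongrightarrow> x" by (simp add: LIM_zero_iff)
  with that show ?thesis by blast
qed

section \<open>Functionals nearly absorb elements of an ideal\<close>

lemma nonpos_if_le_scaled:
  fixes r K :: real
  assumes "\<And>\<epsilon>. 0 < \<epsilon> \<Longrightarrow> r \<le> K * \<epsilon>"
  shows "r \<le> 0"
proof -
  have "((\<lambda>\<epsilon>. K * \<epsilon>) \<longlongrightarrow> K * 0) (at_right 0)" by (intro tendsto_intros)
  then have "r \<le> K * 0"
    by (rule tendsto_lowerbound) (auto simp: eventually_at_filter assms)
  then show ?thesis by simp
qed

lemma exists_phase: "\<exists>c. cmod c = 1 \<and> c * z = complex_of_real (cmod z)"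
proof (cases "z = 0")
  case False
  have "cnj z / cmod z * z = complex_of_real (cmod z)"
    using False by (simp add: complex_norm_square[symmetric] mult.commute power2_eq_square)
  moreover have "cmod (cnj z / cmod z) = 1" using False by (simp add: norm_divide)
  ultimately show ?thesis by blast
qed (auto intro: exI[of _ 1])

text \<open>
  Here \<open>M\<close> is the norm of the restriction of \<open>f\<close> to the subspace \<open>J\<close>; in the third property a phase
  makes the almost maximal value real and nonnegative.
\<close>

lemma functional_norming:
  fixes f :: "'a::complex_normed_vector cdual"
  assumes J0: "0 \<in> J" and J_scale: "\<And>c x. x \<in> J \<Longrightarrow> c *\<^sub>C x \<in> J"
  obtains M where "0 \<le> M" "\<And>x. x \<in> J \<Longrightarrow> cmod (cdual_apply f x) \<le> M * norm x"
    "\<And>\<eta>. 0 < \<eta> \<Longrightarrow> \<exists>x\<in>J. norm x \<le> 1 \<and> M - \<eta> \<le> cmod (cdual_apply f x) \<and>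
      cdual_apply f x = complex_of_real (cmod (cdual_apply f x))"
proof -
  define S where "S = (\<lambda>x. cmod (cdual_apply f x)) ` {x \<in> J. norm x \<le> 1}"
  have bdd: "bdd_above S"
  proof (rule bdd_aboveI)
    fix r assume "r \<in> S"
    then obtain x where "norm x \<le> 1" "r = cmod (cdual_apply f x)" by (auto simp: S_def)
    then show "r \<le> norm f"
      using norm_cdual_apply[of f x] mult_left_mono[of "norm x" 1 "norm f"] by simp
  qed
  have ne: "S \<noteq> {}" using J0 by (auto simp: S_def intro!: exI[of _ 0])
  have up: "cmod (cdual_apply f x) \<le> Sup S" if "x \<in> J" "norm x \<le> 1" for x
    using that bdd by (intro cSup_upper) (auto simp: S_def)
  have "0 \<le> Sup S" using up[OF J0] by (smt (verit) norm_ge_zero norm_zero)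
  moreover have "cmod (cdual_apply f x) \<le> Sup S * norm x" if "x \<in> J" for x
  proof (cases "x = 0")
    case True
    then show ?thesis using norm_cdual_apply[of f x] by simp
  next
    case False
    define c where "c = complex_of_real (inverse (norm x))"
    have "cmod (cdual_apply f (c *\<^sub>C x)) \<le> Sup S"
      using False by (intro up J_scale that) (simp add: norm_scaleC c_def norm_inverse)
    then show ?thesis using False
      by (simp add: cdual_apply_scaleC norm_mult c_def norm_inverse norm_divide field_simps)
  qed
  moreover have "\<exists>x\<in>J. norm x \<le> 1 \<and> Sup S - \<eta> \<le> cmod (cdual_apply f x) \<and>
      cdual_apply f x = complex_of_real (cmod (cdual_apply f x))" if \<eta>: "0 < \<eta>" for \<eta>
  proof -
    obtain r where "r \<in> S" "Sup S - \<eta> < r"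
      using less_cSup_iff[OF ne bdd, of "Sup S - \<eta>"] \<eta> by auto
    then obtain x where x: "x \<in> J" "norm x \<le> 1" "Sup S - \<eta> < cmod (cdual_apply f x)"
      by (auto simp: S_def)
    obtain c where c: "cmod c = 1" "c * cdual_apply f x = complex_of_real (cmod (cdual_apply f x))"
      using exists_phase by blast
    have "cdual_apply f (c *\<^sub>C x) = complex_of_real (cmod (cdual_apply f x))"
      by (simp add: cdual_apply_scaleC c)
    with x c show ?thesis
      by (intro bexI[of _ "c *\<^sub>C x"]) (auto simp: norm_scaleC J_scale)
  qed
  ultimately show ?thesis using that by blast
qed

text \<open>
  Let \<open>x\<close> be a point of the unit ball of \<open>J\<close> at which \<open>f\<close> almost attains its norm, and let \<open>e\<close> almost fix
  \<open>x\<^sup>*\<close>. For \<open>z = y - ye\<close> the product \<open>zx\<^sup>*\<close> is small, so that \<open>x + lz\<close> has norm \<open>1 + O(l\<^sup>2)\<close>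
  by the C*-identity. If \<open>f(z)\<close> were not small, then \<open>f\<close> would grow linearly in \<open>l\<close> along this line and
  exceed its norm.
\<close>

lemma functional_almost_absorbs:
  fixes f :: "'a::cstar_algebra cdual"
  assumes J0: "0 \<in> J" and J_add: "\<And>x y. x \<in> J \<Longrightarrow> y \<in> J \<Longrightarrow> x + y \<in> J"
    and J_scale: "\<And>c x. x \<in> J \<Longrightarrow> c *\<^sub>C x \<in> J"
    and J_left: "\<And>x a. x \<in> J \<Longrightarrow> a * x \<in> J" and J_right: "\<And>x a. x \<in> J \<Longrightarrow> x * a \<in> J"
    and \<epsilon>: "0 < \<epsilon>"
  shows "\<exists>e\<in>J. \<forall>y\<in>J. cmod (cdual_apply f y - cdual_apply f (y * e)) \<le> \<epsilon> * norm y"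
proof -
  obtain M where M: "0 \<le> M" "\<And>x. x \<in> J \<Longrightarrow> cmod (cdual_apply f x) \<le> M * norm x"
    and norming: "\<And>\<eta>. 0 < \<eta> \<Longrightarrow> \<exists>x\<in>J. norm x \<le> 1 \<and> M - \<eta> \<le> cmod (cdual_apply f x) \<and>
      cdual_apply f x = complex_of_real (cmod (cdual_apply f x))"
    using functional_norming[of J f] J0 J_scale by blast
  \<comment> \<open>The argument bounds \<open>\<bar>f(z)\<bar>\<close> by \<open>\<eta>/l + M(\<eta> + l/2)\<close>: first \<open>l\<close> makes \<open>Ml\<close> small, then \<open>\<eta>\<close> the rest.\<close>
  define l where "l = \<epsilon> / (2 * (M + 1))"
  define \<eta> where "\<eta> = min (l * \<epsilon> / 4) (\<epsilon> / (4 * (M + 1)))"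
  have l: "0 < l" and \<eta>: "0 < \<eta>" using \<epsilon> M(1) by (simp_all add: l_def \<eta>_def)
  have small: "\<eta> + M * (l * \<eta> + l\<^sup>2 / 2) \<le> l * \<epsilon>"
  proof -
    have "\<eta> \<le> l * \<epsilon> / 4" by (simp only: \<eta>_def min.cobounded1)
    moreover have "M * (l * \<eta>) \<le> l * (\<epsilon> / 4)"
    proof -
      have "M * \<eta> \<le> M * (\<epsilon> / (4 * (M + 1)))" using M(1) by (intro mult_left_mono) (auto simp: \<eta>_def)
      also have "\<dots> \<le> \<epsilon> / 4" using M(1) \<epsilon> by (simp add: field_simps)
      finally show ?thesis using l by (simp add: mult.left_commute)
    qed
    moreover have "M * (l\<^sup>2 / 2) \<le> l * (\<epsilon> / 4)"
    proof -
      have "M * l \<le> \<epsilon> / 2" using M(1) \<epsilon> by (simp add: l_def field_simps)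
      then have "l * (M * l) \<le> l * (\<epsilon> / 2)" using l by (intro mult_left_mono) auto
      then show ?thesis by (simp add: power2_eq_square mult_ac)
    qed
    ultimately have "\<eta> + (M * (l * \<eta>) + M * (l\<^sup>2 / 2)) \<le> l * \<epsilon> / 4 + (l * (\<epsilon> / 4) + l * (\<epsilon> / 4))"
      by (intro add_mono)
    also have "\<dots> \<le> l * \<epsilon>" using l \<epsilon> by (simp add: field_simps)
    finally show ?thesis by (simp only: distrib_left)
  qed
  obtain x where x: "x \<in> J" "norm x \<le> 1" "M - \<eta> \<le> cmod (cdual_apply f x)"
    "cdual_apply f x = complex_of_real (cmod (cdual_apply f x))"
    using norming[OF \<eta>] by blast
  obtain e c where e: "e = star x * star (star x) * c" "star e = e" "norm (star x - e * star x) \<le> \<eta>"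
    "\<And>y. norm (y - e * y) \<le> norm y"
    using approximate_unit_single[OF \<eta>, of "star x"] by metis
  have eJ: "e \<in> J" using x(1) by (simp add: e(1) star_star J_left J_right)
  have minusJ: "- y \<in> J" if "y \<in> J" for y
    using J_scale[OF that, of "-1"] by (simp add: scaleC_minus_left scaleC_one)
  have unit: "cmod (cdual_apply f (y - y * e)) \<le> \<epsilon>" if y: "y \<in> J" "norm y \<le> 1" for y
  proof -
    define z0 where "z0 = y - y * e"
    have "norm z0 = norm (star y - e * star y)"
      by (metis z0_def norm_star star_diff star_mult e(2))
    then have z0: "norm z0 \<le> 1" using e(4)[of "star y"] y(2) by (simp add: norm_star)
    have "z0 * star x = y * (star x - e * star x)" by (simp add: z0_def algebra_simps)
    also have "norm \<dots> \<le> 1 * \<eta>"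
      by (rule order_trans[OF norm_mult_ineq]) (intro mult_mono y e, auto)
    finally have z0x: "norm (z0 * star x) \<le> \<eta>" by simp
    obtain \<theta> where \<theta>: "cmod \<theta> = 1" "\<theta> * cdual_apply f z0 = complex_of_real (cmod (cdual_apply f z0))"
      using exists_phase by blast
    define z where "z = \<theta> *\<^sub>C z0"
    have zJ: "z \<in> J" using J_scale J_add[OF y(1) minusJ[OF J_right[OF y(1)]], of e]
      by (simp add: z_def z0_def)
    have z: "norm z \<le> 1" "norm (z * star x) \<le> \<eta>"
      using z0 z0x by (simp_all add: z_def norm_scaleC \<theta> mult_scaleC_left)
    have xz: "norm (x * star z) \<le> \<eta>"
      using z(2) norm_star[of "z * star x"] by (simp add: star_simps)
    define w where "w = x + l *\<^sub>R z"
    have wJ: "w \<in> J" unfolding w_def scaleR_scaleC by (intro J_add J_scale x zJ)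
    have "(norm w)\<^sup>2 = norm (x * star x + l *\<^sub>R (x * star z) + l *\<^sub>R (z * star x) + l\<^sup>2 *\<^sub>R (z * star z))"
      by (simp add: cstar_identity'[symmetric]) (simp add: w_def star_simps algebra_simps power2_eq_square)
    also have "\<dots> \<le> 1 + l * \<eta> + l * \<eta> + l\<^sup>2 * 1"
    proof (intro norm_add_rule_thm)
      show "norm (x * star x) \<le> 1" using x(2) by (simp add: cstar_identity' power_le_one)
      show "norm (l *\<^sub>R (x * star z)) \<le> l * \<eta>" "norm (l *\<^sub>R (z * star x)) \<le> l * \<eta>"
        using l xz z(2) by simp_all
      show "norm (l\<^sup>2 *\<^sub>R (z * star z)) \<le> l\<^sup>2 * 1"
        using z(1) by (simp add: cstar_identity' power_le_one mult_left_le)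
    qed
    also have "\<dots> \<le> (1 + (l * \<eta> + l\<^sup>2 / 2))\<^sup>2"
    proof -
      have "1 + 2 * r \<le> (1 + r)\<^sup>2" for r :: real by (simp add: power2_sum)
      from this[of "l * \<eta> + l\<^sup>2 / 2"] show ?thesis by (simp add: algebra_simps)
    qed
    finally have nw: "norm w \<le> 1 + (l * \<eta> + l\<^sup>2 / 2)"
      by (rule power2_le_imp_le) (use l \<eta> in auto)
    have "cdual_apply f w = complex_of_real (cmod (cdual_apply f x) + l * cmod (cdual_apply f z0))"
      using x(4) \<theta>(2) by (simp add: w_def z_def cdual_apply_add cdual_apply_scaleR cdual_apply_scaleC scaleR_conv_of_real)
    then have "cmod (cdual_apply f w) = cmod (cdual_apply f x) + l * cmod (cdual_apply f z0)"
      using l by (simp only: norm_of_real) simp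
    moreover have "cmod (cdual_apply f w) \<le> M * (1 + (l * \<eta> + l\<^sup>2 / 2))"
      using M(2)[OF wJ] mult_left_mono[OF nw M(1)] by linarith
    ultimately have "l * cmod (cdual_apply f z0) \<le> \<eta> + M * (l * \<eta> + l\<^sup>2 / 2)"
      using x(3) by (simp add: distrib_left)
    also note small
    finally show ?thesis using l by (simp add: z0_def)
  qed
  have "cmod (cdual_apply f y - cdual_apply f (y * e)) \<le> \<epsilon> * norm y" if y: "y \<in> J" for y
  proof (cases "y = 0")
    case False
    define r where "r = complex_of_real (inverse (norm y))"
    have "r *\<^sub>C y \<in> J" "norm (r *\<^sub>C y) \<le> 1"
      using False by (simp_all add: J_scale y norm_scaleC r_def norm_inverse)
    then have "cmod (cdual_apply f (r *\<^sub>C y - (r *\<^sub>C y) * e)) \<le> \<epsilon>" by (rule unit)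
    also have "r *\<^sub>C y - (r *\<^sub>C y) * e = r *\<^sub>C (y - y * e)"
      by (simp add: mult_scaleC_left scaleC_diff_right)
    finally have "cmod (cdual_apply f (y - y * e)) \<le> \<epsilon> * norm y"
      using False by (simp add: cdual_apply_scaleC norm_mult r_def norm_inverse norm_divide field_simps)
    then show ?thesis
      by (simp add: linear_diff[OF bounded_linear.linear[OF bounded_linear_cdual_apply]])
  qed simp
  with eJ show ?thesis by blast
qed

section \<open>The bidual as a bimodule\<close>

lemmas cdual_apply_diff = linear_diff[OF bounded_linear.linear[OF bounded_linear_cdual_apply]]

lemma arens_mult_assoc: "\<Phi> \<star> \<Psi> \<star> \<Omega> = \<Phi> \<star> (\<Psi> \<star> \<Omega>)"
proof -
  have "cdual_translate (bidual_act \<Omega> f) a = bidual_act \<Omega> (cdual_translate f a)" for f a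
    by (rule cdual_eqI)
      (simp add: cdual_translate.rep_eq bidual_act.rep_eq, rule arg_cong[where f = "cdual_apply \<Omega>"],
        rule cdual_eqI, simp add: cdual_translate.rep_eq mult.assoc)
  then have "bidual_act (\<Psi> \<star> \<Omega>) f = bidual_act \<Psi> (bidual_act \<Omega> f)" for f
    by (intro cdual_eqI) (simp add: bidual_act.rep_eq arens_mult.rep_eq)
  then show ?thesis by (intro cdual_eqI) (simp add: arens_mult.rep_eq)
qed

lemma bidual_act_add_left: "bidual_act (\<Phi> + \<Psi>) f = bidual_act \<Phi> f + bidual_act \<Psi> f"
  by (rule cdual_eqI) (simp add: bidual_act.rep_eq plus_cdual.rep_eq)

lemma bidual_act_scaleC_left: "bidual_act (c *\<^sub>C \<Phi>) f = c *\<^sub>C bidual_act \<Phi> f"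
  by (rule cdual_eqI) (simp add: bidual_act.rep_eq scaleC_cdual.rep_eq)

lemma arens_mult_scaleC:
  "(c *\<^sub>C \<Phi>) \<star> \<Psi> = c *\<^sub>C (\<Phi> \<star> \<Psi>)" "\<Phi> \<star> (c *\<^sub>C \<Psi>) = c *\<^sub>C (\<Phi> \<star> \<Psi>)"
  by (rule cdual_eqI, simp add: arens_mult.rep_eq scaleC_cdual.rep_eq bidual_act_scaleC_left cdual_apply_scaleC)+

lemma norm_arens_mult: "norm (\<Phi> \<star> \<Psi>) \<le> norm \<Phi> * norm \<Psi>"
proof (rule norm_cdual_bound)
  fix f
  have "cmod (cdual_apply \<Phi> (bidual_act \<Psi> f)) \<le> norm \<Phi> * norm (bidual_act \<Psi> f)"
    by (rule norm_cdual_apply)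
  also have "\<dots> \<le> norm \<Phi> * (norm \<Psi> * norm f)"
    by (intro mult_left_mono norm_bidual_act norm_ge_zero)
  finally show "cmod (cdual_apply (\<Phi> \<star> \<Psi>) f) \<le> norm \<Phi> * norm \<Psi> * norm f"
    by (simp add: arens_mult.rep_eq mult.assoc)
qed simp

lemma bounded_bilinear_arens_mult: "bounded_bilinear (arens_mult :: 'a::cstar_algebra bidual \<Rightarrow> _)"
proof
  show "\<exists>K. \<forall>\<Phi> \<Psi> :: 'a bidual. norm (\<Phi> \<star> \<Psi>) \<le> norm \<Phi> * norm \<Psi> * K"
    using norm_arens_mult by (intro exI[of _ 1]) auto
qed (simp_all add: scaleR_scaleC arens_mult_scaleC,
    (rule cdual_eqI, simp add: arens_mult.rep_eq plus_cdual.rep_eq bidual_act_add_left cdual_apply_add)+)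

lemma bidual_embed_scaleC: "bidual_embed (c *\<^sub>C x) = c *\<^sub>C bidual_embed x"
  by (rule cdual_eqI) (simp add: bidual_embed.rep_eq scaleC_cdual.rep_eq cdual_apply_scaleC)

lemma norm_bidual_embed: "norm (bidual_embed x) \<le> norm x"
  by (rule norm_cdual_bound) (simp_all add: bidual_embed.rep_eq norm_cdual_apply mult.commute[of "norm x"])

lemma bounded_linear_bidual_embed: "bounded_linear (bidual_embed :: 'a::complex_normed_vector \<Rightarrow> _)"
proof (rule bounded_linear_intro[where K = 1])
  show "bidual_embed (x + y) = bidual_embed x + bidual_embed y" for x y :: 'a
    by (rule cdual_eqI) (simp add: bidual_embed.rep_eq plus_cdual.rep_eq cdual_apply_add)
qed (simp_all add: scaleR_scaleC bidual_embed_scaleC norm_bidual_embed)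

interpretation arens: bounded_bilinear "arens_mult :: 'a::cstar_algebra bidual \<Rightarrow> _"
  by (rule bounded_bilinear_arens_mult)

lemmas embed_add = linear_add[OF bounded_linear.linear[OF bounded_linear_bidual_embed]]
lemmas embed_diff = linear_diff[OF bounded_linear.linear[OF bounded_linear_bidual_embed]]
lemmas embed_zero = linear_0[OF bounded_linear.linear[OF bounded_linear_bidual_embed]]

lemma bidual_act_embed: "cdual_apply (bidual_act (bidual_embed a) f) x = cdual_apply f (x * a)"
  by (simp add: bidual_act.rep_eq bidual_embed.rep_eq cdual_translate.rep_eq)

lemma embed_arens_apply:
  "cdual_apply (bidual_embed a \<star> \<Psi>) f = cdual_apply \<Psi> (cdual_translate f a)"
  by (simp add: arens_mult.rep_eq bidual_embed.rep_eq bidual_act.rep_eq)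

text \<open>
  The functionals \<open>f(\<cdot>e)\<close> are dense in the dual, and \<open>\<Psi>\<close> vanishes on them.
\<close>

lemma right_nondegenerate:
  fixes \<Psi> :: "'a::cstar_algebra bidual"
  assumes "\<And>a. \<Psi> \<star> bidual_embed a = 0"
  shows "\<Psi> = 0"
proof (rule cdual_eqI)
  fix f :: "'a cdual"
  have "cmod (cdual_apply \<Psi> f) \<le> norm \<Psi> * \<epsilon>" if \<epsilon>: "0 < \<epsilon>" for \<epsilon>
  proof -
    obtain e where e: "\<And>y. cmod (cdual_apply f y - cdual_apply f (y * e)) \<le> \<epsilon> * norm y"
      using functional_almost_absorbs[of UNIV \<epsilon> f] \<epsilon> by auto
    have "norm (f - bidual_act (bidual_embed e) f) \<le> \<epsilon>"
      using e that by (intro norm_cdual_bound) (auto simp: minus_cdual.rep_eq bidual_act_embed)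
    moreover have "cdual_apply \<Psi> (f - bidual_act (bidual_embed e) f) = cdual_apply \<Psi> f"
      using arg_cong[OF assms[of e], of "\<lambda>\<Omega>. cdual_apply \<Omega> f"]
      by (simp add: cdual_apply_diff arens_mult.rep_eq zero_cdual.rep_eq)
    ultimately show ?thesis
      by (metis norm_cdual_apply mult_left_mono norm_ge_zero order_trans)
  qed
  then have "cmod (cdual_apply \<Psi> f) \<le> 0" by (rule nonpos_if_le_scaled)
  then show "cdual_apply \<Psi> f = cdual_apply 0 f" by (simp add: zero_cdual.rep_eq)
qed

text \<open>
  The involution of the dual, which exchanges left and right translations of functionals.
\<close>

lift_definition cdual_star :: "'a::cstar_algebra cdual \<Rightarrow> 'a cdual"
  is "\<lambda>f x. cnj (f (star x))"
proof -
  fix f :: "'a \<Rightarrow> complex" assume f: "bounded_clinear f"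
  then obtain K where K: "\<And>x. cmod (f x) \<le> norm x * K"
    using bounded_linear.bounded bounded_clinear_iff by blast
  show "bounded_clinear (\<lambda>x. cnj (f (star x)))"
  proof (rule bounded_clinear_intro)
    show "cmod (cnj (f (star x))) \<le> norm x * K" for x using K[of "star x"] by (simp add: norm_star)
  qed (use f in \<open>simp_all add: bounded_clinear_iff star_simps scaleC_complex_def
      linear_add[OF bounded_linear.linear]\<close>)
qed

lemma left_nondegenerate:
  fixes \<Psi> :: "'a::cstar_algebra bidual"
  assumes "\<And>a. bidual_embed a \<star> \<Psi> = 0"
  shows "\<Psi> = 0"
proof (rule cdual_eqI)
  fix f :: "'a cdual"
  have "cmod (cdual_apply \<Psi> f) \<le> norm \<Psi> * \<epsilon>" if \<epsilon>: "0 < \<epsilon>" for \<epsilon>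
  proof -
    obtain e where e: "\<And>y. cmod (cdual_apply (cdual_star f) y - cdual_apply (cdual_star f) (y * e)) \<le> \<epsilon> * norm y"
      using functional_almost_absorbs[of UNIV \<epsilon> "cdual_star f"] \<epsilon> by auto
    have "norm (f - cdual_translate f (star e)) \<le> \<epsilon>"
    proof (rule norm_cdual_bound)
      fix y
      have "cmod (cdual_apply f y - cdual_apply f (star e * y)) =
          cmod (cnj (cdual_apply f y - cdual_apply f (star e * y)))" by (simp only: complex_mod_cnj)
      also have "\<dots> \<le> \<epsilon> * norm y"
        using e[of "star y"] by (simp add: cdual_star.rep_eq star_simps norm_star)
      finally show "cmod (cdual_apply (f - cdual_translate f (star e)) y) \<le> \<epsilon> * norm y"
        by (simp add: minus_cdual.rep_eq cdual_translate.rep_eq)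
    qed (use that in simp)
    moreover have "cdual_apply \<Psi> (f - cdual_translate f (star e)) = cdual_apply \<Psi> f"
      using arg_cong[OF assms[of "star e"], of "\<lambda>\<Omega>. cdual_apply \<Omega> f"]
      by (simp add: cdual_apply_diff embed_arens_apply zero_cdual.rep_eq)
    ultimately show ?thesis
      by (metis norm_cdual_apply mult_left_mono norm_ge_zero order_trans)
  qed
  then have "cmod (cdual_apply \<Psi> f) \<le> 0" by (rule nonpos_if_le_scaled)
  then show "cdual_apply \<Psi> f = cdual_apply 0 f" by (simp add: zero_cdual.rep_eq)
qed

text \<open>
  The functional \<open>y \<mapsto> f([y, x])\<close> only sees the restriction of \<open>f\<close> to the ideal \<open>J\<close> of all \<open>k\<close>
  with \<open>\<Psi>k = 0\<close> and \<open>\<Psi>Ak = 0\<close>, since it contains the commutators. On \<open>J\<close> it may therefore be replaced by \<open>f([y, x]e)\<close>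
  with \<open>e \<in> J\<close>, where \<open>\<Psi>\<close> vanishes.
\<close>

lemma central_if_kills_commutators:
  fixes \<Psi> :: "'a::cstar_algebra bidual"
  assumes kills: "\<And>a b. \<Psi> \<star> bidual_embed (commutator a b) = 0"
    "\<And>x a b. \<Psi> \<star> bidual_embed (x * commutator a b) = 0"
  shows "\<Psi> \<star> bidual_embed x = bidual_embed x \<star> \<Psi>"
proof (rule cdual_eqI)
  fix f :: "'a cdual"
  define J where "J = {k. \<Psi> \<star> bidual_embed k = 0 \<and> (\<forall>a. \<Psi> \<star> bidual_embed (a * k) = 0)}"
  have J: "0 \<in> J" "\<And>x y. x \<in> J \<Longrightarrow> y \<in> J \<Longrightarrow> x + y \<in> J" "\<And>c x. x \<in> J \<Longrightarrow> c *\<^sub>C x \<in> J"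
    "\<And>x a. x \<in> J \<Longrightarrow> a * x \<in> J" "\<And>x a. x \<in> J \<Longrightarrow> x * a \<in> J"
    by (auto simp: J_def distrib_left embed_add arens.add_right embed_zero arens.zero_right
        mult_scaleC_right bidual_embed_scaleC arens_mult_scaleC scaleC_zero_right mult.assoc[symmetric])
      (simp_all add: bidual_embed_mult arens_mult_assoc[symmetric] arens.zero_left)
  define g where "g = bidual_act (bidual_embed x) f - cdual_translate f x"
  have g: "cdual_apply g y = cdual_apply f (commutator y x)" for y
    by (simp add: g_def minus_cdual.rep_eq bidual_act_embed cdual_translate.rep_eq commutator_def cdual_apply_diff)
  have "cmod (cdual_apply \<Psi> g) \<le> norm \<Psi> * (2 * norm x * \<epsilon>)" if \<epsilon>: "0 < \<epsilon>" for \<epsilon>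
  proof -
    obtain e where e: "e \<in> J"
      "\<And>y. y \<in> J \<Longrightarrow> cmod (cdual_apply f y - cdual_apply f (y * e)) \<le> \<epsilon> * norm y"
      using functional_almost_absorbs[of J \<epsilon> f] J \<epsilon> by auto
    define g' where "g' = bidual_act (bidual_embed (x * e)) f - bidual_act (bidual_embed e) (cdual_translate f x)"
    have g': "cdual_apply g' y = cdual_apply f (commutator y x * e)" for y
      by (simp add: g'_def minus_cdual.rep_eq bidual_act_embed cdual_translate.rep_eq commutator_def
          cdual_apply_diff left_diff_distrib mult.assoc)
    have "norm (g - g') \<le> 2 * norm x * \<epsilon>"
    proof (rule norm_cdual_bound)
      fix y
      have "commutator y x \<in> J" using kills by (simp add: J_def)
      then have "cmod (cdual_apply (g - g') y) \<le> \<epsilon> * norm (commutator y x)"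
        using e(2) by (simp add: minus_cdual.rep_eq g g')
      also have "norm (commutator y x) \<le> norm y * norm x + norm x * norm y"
        unfolding commutator_def
        by (rule order_trans[OF norm_triangle_ineq4]) (intro add_mono norm_mult_ineq)
      finally show "cmod (cdual_apply (g - g') y) \<le> 2 * norm x * \<epsilon> * norm y"
        using \<epsilon> by (simp add: algebra_simps)
    qed (use \<epsilon> in simp)
    moreover have "cdual_apply \<Psi> g' = 0"
    proof -
      have "cdual_apply (\<Psi> \<star> bidual_embed (x * e)) f = 0" "cdual_apply (\<Psi> \<star> bidual_embed e) (cdual_translate f x) = 0"
        using e(1) by (simp_all add: J_def zero_cdual.rep_eq)
      then show ?thesis by (simp add: g'_def cdual_apply_diff arens_mult.rep_eq)
    qed
    then have "cdual_apply \<Psi> (g - g') = cdual_apply \<Psi> g" by (simp add: cdual_apply_diff)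
    ultimately show ?thesis
      using norm_cdual_apply[of \<Psi> "g - g'"] mult_left_mono[of "norm (g - g')" "2 * norm x * \<epsilon>" "norm \<Psi>"]
      by simp
  qed
  then have "cmod (cdual_apply \<Psi> g) \<le> 0"
    by (intro nonpos_if_le_scaled[of _ "norm \<Psi> * (2 * norm x)"]) (simp add: mult.assoc)
  then have "cdual_apply \<Psi> g = 0" by simp
  then show "cdual_apply (\<Psi> \<star> bidual_embed x) f = cdual_apply (bidual_embed x \<star> \<Psi>) f"
    by (simp add: g_def cdual_apply_diff embed_arens_apply) (simp add: arens_mult.rep_eq)
qed

section \<open>Weak limits in dual spaces\<close>

lemma tendsto_product_coordinate:
  fixes g :: "'b \<Rightarrow> 'c::topological_space"
  assumes "(m \<longlongrightarrow> g) F"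
  shows "((\<lambda>i. m i f) \<longlongrightarrow> g f) F"
proof (rule topological_tendstoI)
  fix S :: "'c set" assume "open S" "g f \<in> S"
  then have "open ((\<lambda>h :: 'b \<Rightarrow> 'c. h f) -` S)" "g \<in> (\<lambda>h. h f) -` S"
    by (auto intro!: open_vimage)
  from topological_tendstoD[OF assms this] show "\<forall>\<^sub>F i in F. m i f \<in> S" by simp
qed

text \<open>
  The Banach--Alaoglu theorem, in a form for bounded nets: by Tychonoff's theorem the net has a
  cluster point in a product of discs, and linearity survives in the pointwise limit along a finer
  filter.
\<close>

lemma bounded_net_weak_limit:
  fixes m :: "'i \<Rightarrow> 'b::complex_normed_vector cdual"
  assumes F: "F \<noteq> bot" and K: "eventually (\<lambda>i. norm (m i) \<le> K) F"
  obtains F' \<xi> where "F' \<noteq> bot" "F' \<le> F"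
    "\<And>f. ((\<lambda>i. cdual_apply (m i) f) \<longlongrightarrow> cdual_apply \<xi> f) F'"
proof -
  define S :: "('b \<Rightarrow> complex) set" where "S = PiE UNIV (\<lambda>f. cball 0 (K * norm f))"
  have "compactin (product_topology (\<lambda>_. euclidean) UNIV) S"
    unfolding S_def by (simp add: compactin_PiE)
  then have "compact S"
    by (simp add: euclidean_product_topology)
  moreover have "eventually (\<lambda>g. g \<in> S) (filtermap (\<lambda>i. cdual_apply (m i)) F)"
    unfolding eventually_filtermap using K
  proof eventually_elim
    case (elim i)
    have "cmod (cdual_apply (m i) f) \<le> K * norm f" for f
      using norm_cdual_apply[of "m i" f] mult_right_mono[OF elim, of "norm f"] by simp
    then show ?case by (simp add: S_def PiE_iff)
  qed
  ultimately obtain g where g: "g \<in> S" "inf (nhds g) (filtermap (\<lambda>i. cdual_apply (m i)) F) \<noteq> bot"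
    using F unfolding compact_filter by (metis filtermap_bot_iff)
  define F' where "F' = inf F (filtercomap (\<lambda>i. cdual_apply (m i)) (nhds g))"
  have F': "F' \<noteq> bot"
  proof
    assume "F' = bot"
    then have "eventually (\<lambda>_. False) (inf F (filtercomap (\<lambda>i. cdual_apply (m i)) (nhds g)))"
      by (simp add: F'_def)
    then obtain P Q where P: "eventually P F" and Q: "eventually Q (nhds g)"
      and PQ: "\<And>i. P i \<Longrightarrow> Q (cdual_apply (m i)) \<Longrightarrow> False"
      unfolding eventually_inf eventually_filtercomap by blast
    have "eventually (\<lambda>h. \<not> Q h) (filtermap (\<lambda>i. cdual_apply (m i)) F)"
      unfolding eventually_filtermap using P by eventually_elim (use PQ in blast)
    then have "eventually (\<lambda>_. False) (inf (nhds g) (filtermap (\<lambda>i. cdual_apply (m i)) F))"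
      using Q unfolding eventually_inf by blast
    then show False using g(2) by (simp add: trivial_limit_def)
  qed
  have "filterlim (\<lambda>i. cdual_apply (m i)) (nhds g) F'"
    unfolding F'_def by (simp add: filterlim_iff_le_filtercomap)
  then have lim: "((\<lambda>i. cdual_apply (m i) f) \<longlongrightarrow> g f) F'" for f
    by (rule tendsto_product_coordinate)
  have "bounded_clinear g"
  proof (rule bounded_clinear_intro)
    show "g (x + y) = g x + g y" for x y
      using tendsto_unique[OF F' lim[of "x + y"]] tendsto_add[OF lim[of x] lim[of y]]
      by (simp add: cdual_apply_add)
    show "g (c *\<^sub>C x) = c *\<^sub>C g x" for c x
      using tendsto_unique[OF F' lim[of "c *\<^sub>C x"]] tendsto_mult[OF tendsto_const lim[of x], of c]
      by (simp add: cdual_apply_scaleC scaleC_complex_def)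
    show "cmod (g x) \<le> norm x * K" for x
      using g(1) by (auto simp: S_def PiE_iff mult.commute)
  qed
  then have "cdual_apply (Cdual g) = g" by (simp add: Cdual_inverse)
  with F' lim that[of F' "Cdual g"] show ?thesis by (simp add: F'_def)
qed

lemma tendsto_cdual_apply:
  assumes "(m \<longlongrightarrow> \<xi>) F"
  shows "((\<lambda>i. cdual_apply (m i) f) \<longlongrightarrow> cdual_apply \<xi> f) F"
  using bounded_linear.tendsto[OF bounded_linear_cdual_apply[of "bidual_embed f"] assms]
  by (simp add: bidual_embed.rep_eq)

lemma approximate_unit_filter:
  obtains F :: "'a::cstar_algebra filter" where "F \<noteq> bot" "eventually (\<lambda>e. norm e \<le> 2) F"
    "\<And>x. ((\<lambda>e. e * x) \<longlongrightarrow> x) F" "\<And>x. ((\<lambda>e. x * e) \<longlongrightarrow> x) F"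
proof -
  define A :: "'a set \<times> real \<Rightarrow> 'a set" where "A = (\<lambda>(X, \<eta>). {e. norm e \<le> 2 \<and>
    (\<forall>x\<in>X. norm (x - e * x) \<le> \<eta> \<and> norm (x - x * e) \<le> \<eta>)})"
  define B :: "('a set \<times> real) set" where "B = {(X, \<eta>). finite X \<and> 0 < \<eta>}"
  define F where "F = (INF b\<in>B. principal (A b))"
  have ev: "eventually P F \<longleftrightarrow> (\<exists>b\<in>B. \<forall>e\<in>A b. P e)" for P
    unfolding F_def
  proof (subst eventually_INF_base)
    show "B \<noteq> {}" by (auto simp: B_def intro!: exI[of _ "{}"] exI[of _ 1])
    fix a b assume ab: "a \<in> B" "b \<in> B"
    show "\<exists>c\<in>B. principal (A c) \<le> inf (principal (A a)) (principal (A b))"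
      by (rule bexI[of _ "(fst a \<union> fst b, min (snd a) (snd b))"])
        (use ab in \<open>auto simp: A_def B_def\<close>)
  qed (auto simp: eventually_principal)
  have "A b \<noteq> {}" if "b \<in> B" for b
  proof -
    have "finite (fst b)" "0 < snd b" using that by (auto simp: B_def)
    then obtain e where "norm e \<le> 2" "\<And>x. x \<in> fst b \<Longrightarrow> norm (x - e * x) \<le> snd b"
      "\<And>x. x \<in> fst b \<Longrightarrow> norm (x - x * e) \<le> snd b"
      using approximate_unit by metis
    then have "e \<in> A b" by (simp add: A_def case_prod_beta)
    then show ?thesis by blast
  qed
  then have "F \<noteq> bot" unfolding trivial_limit_def ev by blast
  moreover have "eventually (\<lambda>e. norm e \<le> 2) F"
    unfolding ev by (rule bexI[of _ "({}, 1)"]) (auto simp: A_def B_def)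
  moreover have "((\<lambda>e. e * x) \<longlongrightarrow> x) F" "((\<lambda>e. x * e) \<longlongrightarrow> x) F" for x
  proof -
    have "eventually (\<lambda>e. norm (x - e * x) < \<eta> \<and> norm (x - x * e) < \<eta>) F" if "0 < \<eta>" for \<eta>
      unfolding ev by (rule bexI[of _ "({x}, \<eta> / 2)"]) (use that in \<open>auto simp: A_def B_def\<close>)
    then show "((\<lambda>e. e * x) \<longlongrightarrow> x) F" "((\<lambda>e. x * e) \<longlongrightarrow> x) F"
      unfolding tendsto_iff dist_norm by (simp_all add: norm_minus_commute eventually_conj_iff)
  qed
  ultimately show ?thesis using that by blast
qed

section \<open>Cancellation\<close>

text \<open>
  By \<open>approximate_unit_single\<close>, \<open>k\<close> lies in the closure of \<open>kk\<^sup>*A\<close>.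
\<close>

lemma cancel_star:
  fixes \<Psi> :: "'a::cstar_algebra bidual"
  assumes "\<Psi> \<star> bidual_embed (k * star k) = 0"
  shows "\<Psi> \<star> bidual_embed k = 0"
proof -
  obtain c where c: "(\<lambda>n. k * star k * c n) \<longlonglongrightarrow> k" using in_closure_mult by blast
  have "(\<lambda>n. \<Psi> \<star> bidual_embed (k * star k * c n)) \<longlonglongrightarrow> \<Psi> \<star> bidual_embed k"
    by (intro arens.tendsto tendsto_const bounded_linear.tendsto[OF bounded_linear_bidual_embed] c)
  moreover have "\<Psi> \<star> bidual_embed (k * star k * c n) = 0" for n
    using assms by (simp only: bidual_embed_mult[of "k * star k"] arens_mult_assoc[symmetric] arens.zero_left)
  ultimately show ?thesis using LIMSEQ_unique[OF tendsto_const] by fastforce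
qed

lemma cancel_sandwich:
  fixes \<Psi> :: "'a::cstar_algebra bidual"
  assumes "\<And>y. \<Psi> \<star> bidual_embed (k * y * k) = 0"
  shows "\<Psi> \<star> bidual_embed k = 0"
proof -
  have "(\<Psi> \<star> bidual_embed k) \<star> bidual_embed (star k * star (star k)) = 0"
    using assms[of "star k"] by (simp add: star_star bidual_embed_mult arens_mult_assoc)
  then have "(\<Psi> \<star> bidual_embed k) \<star> bidual_embed (star k) = 0" by (rule cancel_star)
  then have "\<Psi> \<star> bidual_embed (k * star k) = 0"
    by (simp add: bidual_embed_mult arens_mult_assoc)
  then show ?thesis by (rule cancel_star)
qed

section \<open>Twisted anti-derivations vanish\<close>

text \<open>
  The properties of the map \<open>a \<mapsto> T(a) - \<xi>a\<close> obtained from anti-derivability at zero. The last summand is \<open>2\<xi>[b, a]\<close>.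
\<close>

locale twisted_anti_derivation =
  fixes \<delta> :: "'a::cstar_algebra \<Rightarrow> 'a bidual" and \<xi> :: "'a bidual"
  assumes bounded: "bounded_linear \<delta>" and scaleC: "\<delta> (c *\<^sub>C a) = c *\<^sub>C \<delta> a"
    and central: "bidual_embed a \<star> \<xi> = \<xi> \<star> bidual_embed a"
    and mult: "\<delta> (a * b) = \<delta> b \<star> bidual_embed a + bidual_embed b \<star> \<delta> a +
      (\<xi> \<star> bidual_embed (commutator b a) + \<xi> \<star> bidual_embed (commutator b a))"
begin

lemma \<delta>_add: "\<delta> (a + b) = \<delta> a + \<delta> b" and \<delta>_zero: "\<delta> 0 = 0"
  using bounded bounded_linear.linear linear_add linear_0 by blast+

lemma central_left: "bidual_embed a \<star> (\<xi> \<star> \<Psi>) = \<xi> \<star> (bidual_embed a \<star> \<Psi>)"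
  using central by (metis arens_mult_assoc)

lemma zero_right: "\<delta> b \<star> bidual_embed x = 0 \<Longrightarrow> \<delta> b \<star> bidual_embed (x * y) = 0"
  by (simp add: bidual_embed_mult arens_mult_assoc[symmetric] arens.zero_left)

text \<open>
  The two ways of computing \<open>\<delta>(abc)\<close>. The terms with \<open>\<xi>\<close> cancel, as does \<open>c\<delta>(b)a\<close>.
\<close>

lemma associativity_defect:
  "\<delta> c \<star> bidual_embed (commutator a b) + bidual_embed (commutator c b) \<star> \<delta> a = 0"
proof -
  note expand = mult commutator_def embed_add embed_diff bidual_embed_mult arens.add_left
    arens.add_right arens.diff_left arens.diff_right arens_mult_assoc central central_left
  have "\<delta> ((a * b) * c) = \<delta> (a * (b * c))" by (simp add: mult.assoc)
  moreover have "\<delta> ((a * b) * c) = \<delta> c \<star> bidual_embed (a * b) +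
      bidual_embed c \<star> (\<delta> b \<star> bidual_embed a + bidual_embed b \<star> \<delta> a +
        (\<xi> \<star> bidual_embed (commutator b a) + \<xi> \<star> bidual_embed (commutator b a))) +
      (\<xi> \<star> bidual_embed (commutator c (a * b)) + \<xi> \<star> bidual_embed (commutator c (a * b)))"
    by (simp only: mult)
  moreover have "\<delta> (a * (b * c)) = (\<delta> c \<star> bidual_embed b + bidual_embed c \<star> \<delta> b +
        (\<xi> \<star> bidual_embed (commutator c b) + \<xi> \<star> bidual_embed (commutator c b))) \<star> bidual_embed a +
      bidual_embed (b * c) \<star> \<delta> a +
      (\<xi> \<star> bidual_embed (commutator (b * c) a) + \<xi> \<star> bidual_embed (commutator (b * c) a))"
    by (simp only: mult)
  ultimately show ?thesis
    by (simp add: expand(2-) algebra_simps)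
qed

lemma kills_own_commutators: "\<delta> b \<star> bidual_embed (commutator a b) = 0"
  using associativity_defect[of b a b] by (simp add: commutator_def embed_zero arens.zero_left)

lemma kills_own_commutators_left: "\<delta> b \<star> bidual_embed (x * commutator a b) = 0"
proof -
  have "x * commutator a b = commutator (x * a) b - commutator x b * a"
    by (simp add: commutator_def algebra_simps)
  then show ?thesis
    by (simp add: embed_diff arens.diff_right kills_own_commutators zero_right)
qed

lemma exchange: "\<delta> b \<star> bidual_embed (commutator x c) = - (\<delta> c \<star> bidual_embed (commutator x b))"
proof -
  have "commutator x (b + c) = commutator x b + commutator x c"
    by (simp add: commutator_def algebra_simps)
  then show ?thesis
    using kills_own_commutators[of "b + c" x]
    by (simp add: \<delta>_add embed_add arens.add_left arens.add_right kills_own_commutators eq_neg_iff_add_eq_0 add.commute)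
qed

text \<open>
  Exchanging \<open>b\<close> and \<open>c\<close> in the first commutator turns \<open>\<delta>(b)[x, c]y[x, c]\<close> into
  \<open>-\<delta>(c)[x, b]y[x, c]\<close>, where \<open>\<delta>(c)\<close> meets a commutator with its own argument.
\<close>

lemma kills_commutators: "\<delta> b \<star> bidual_embed (commutator x c) = 0"
proof (rule cancel_sandwich)
  fix y
  have "\<delta> b \<star> bidual_embed (commutator x c * y * commutator x c) =
      - (\<delta> c \<star> bidual_embed (commutator x b)) \<star> bidual_embed (y * commutator x c)"
    by (simp only: exchange[of b x c, symmetric]) (simp only: bidual_embed_mult arens_mult_assoc)
  also have "\<dots> = - (\<delta> c \<star> bidual_embed ((commutator x b * y) * commutator x c))"
    by (simp only: arens.minus_left bidual_embed_mult arens_mult_assoc)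
  also have "\<dots> = 0" by (simp only: kills_own_commutators_left minus_zero)
  finally show "\<delta> b \<star> bidual_embed (commutator x c * y * commutator x c) = 0" .
qed

lemma kills_commutators_left: "\<delta> b \<star> bidual_embed (a * commutator x c) = 0"
proof -
  have "a * commutator x c = commutator (a * x) c - commutator a c * x"
    by (simp add: commutator_def algebra_simps)
  then show ?thesis
    by (simp add: embed_diff arens.diff_right kills_commutators zero_right)
qed

text \<open>
  Multiply the rule for \<open>\<delta>(ab)\<close> on the right by \<open>y[b, a]\<close>: all terms with \<open>\<delta>\<close> vanish.
\<close>

lemma twist_kills_commutators: "\<xi> \<star> bidual_embed (commutator b a) = 0"
proof (rule cancel_sandwich)
  fix y
  define k where "k = commutator b a"
  have "\<delta> (a * b) \<star> bidual_embed (y * k) = \<delta> b \<star> bidual_embed (a * y * k) +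
      bidual_embed b \<star> (\<delta> a \<star> bidual_embed (y * k)) +
      (\<xi> \<star> bidual_embed (k * y * k) + \<xi> \<star> bidual_embed (k * y * k))"
    by (simp add: mult k_def[symmetric] arens.add_left bidual_embed_mult arens_mult_assoc)
  then have "2 *\<^sub>R (\<xi> \<star> bidual_embed (k * y * k)) = 0"
    by (simp add: k_def kills_commutators_left arens.zero_right scaleR_2)
  then show "\<xi> \<star> bidual_embed (commutator b a * y * commutator b a) = 0"
    by (simp add: k_def)
qed

lemma range_central: "\<delta> b \<star> bidual_embed a = bidual_embed a \<star> \<delta> b"
  by (rule central_if_kills_commutators) (rule kills_commutators kills_commutators_left)+

lemma derivation: "\<delta> (a * b) = \<delta> b \<star> bidual_embed a + \<delta> a \<star> bidual_embed b"
  by (simp add: mult twist_kills_commutators range_central)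

text \<open>
  For \<open>p = bb\<^sup>*\<close> also \<open>ap = 0\<close>, and the derivation rule for \<open>ap\<close> multiplied by \<open>p\<close> leaves
  \<open>\<delta>(a)p\<^sup>2 = 0\<close>, since \<open>\<delta>(p)ap = 0\<close>. Cancellation does the rest.
\<close>

lemma zero_product_preserving:
  assumes "a * b = 0"
  shows "\<delta> a \<star> bidual_embed b = 0"
proof (rule cancel_star)
  define p where "p = b * star b"
  have ap: "a * p = 0" using assms by (simp add: p_def mult.assoc[symmetric])
  have "0 = (\<delta> p \<star> bidual_embed a + \<delta> a \<star> bidual_embed p) \<star> bidual_embed p"
    using derivation[of a p] by (simp add: ap \<delta>_zero arens.zero_left)
  also have "\<dots> = \<delta> p \<star> bidual_embed (a * p) + \<delta> a \<star> bidual_embed (p * p)"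
    by (simp add: arens.add_left bidual_embed_mult arens_mult_assoc)
  finally have "\<delta> a \<star> bidual_embed (p * p) = 0"
    by (simp add: ap embed_zero arens.zero_right)
  moreover have "star p = p" by (simp add: p_def star_simps)
  ultimately have "\<delta> a \<star> bidual_embed (p * star p) = 0" by simp
  then show "\<delta> a \<star> bidual_embed (b * star b) = 0"
    unfolding p_def[symmetric] by (rule cancel_star)
qed

text \<open>
  By balancing, \<open>\<delta>(ba)c = \<delta>(b)ac\<close>, whereas the derivation rule gives
  \<open>\<delta>(ba)c = \<delta>(a)bc + \<delta>(b)ac\<close>. Hence \<open>\<delta>(a)bc = 0\<close> for all \<open>b, c\<close>.
\<close>

theorem vanishes: "\<delta> a = 0"
proof -
  interpret zero_product_form "\<lambda>a b. \<delta> a \<star> bidual_embed b"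
  proof (intro zero_product_form.intro zero_product_form_axioms.intro)
    show "bounded_bilinear (\<lambda>a b. \<delta> a \<star> bidual_embed b)"
      by (rule arens.comp[OF bounded bounded_linear_bidual_embed])
  qed (simp_all add: scaleC bidual_embed_scaleC arens_mult_scaleC zero_product_preserving)
  have "\<delta> a \<star> bidual_embed b \<star> bidual_embed c = 0" for b c
  proof -
    have "(\<delta> a \<star> bidual_embed b + \<delta> b \<star> bidual_embed a) \<star> bidual_embed c = \<delta> b \<star> bidual_embed (a * c)"
      using balanced[of b a c] by (simp add: derivation)
    then show ?thesis by (simp add: arens.add_left bidual_embed_mult arens_mult_assoc)
  qed
  then show ?thesis by (rule right_nondegenerate[OF right_nondegenerate])
qed

end

section \<open>Anti-derivability at zero\<close>

lemma balanced_identity: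
  fixes T :: "'a::cstar_algebra \<Rightarrow> 'a bidual"
  assumes T: "bounded_clinear T" and anti: "anti_derivable_at_zero T"
  shows "T c \<star> bidual_embed (a * b) + bidual_embed c \<star> T (a * b) =
    T (b * c) \<star> bidual_embed a + bidual_embed (b * c) \<star> T a"
proof -
  have lin: "bounded_linear T" and T_scaleC: "\<And>c x. T (c *\<^sub>C x) = c *\<^sub>C T x"
    using T by (auto simp: bounded_clinear_iff)
  interpret l: bounded_bilinear "\<lambda>a b. T b \<star> bidual_embed a"
    by (rule bounded_bilinear.flip) (rule arens.comp[OF lin bounded_linear_bidual_embed])
  interpret r: bounded_bilinear "\<lambda>a b. bidual_embed b \<star> T a"
    by (rule bounded_bilinear.flip) (rule arens.comp[OF bounded_linear_bidual_embed lin])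
  interpret zero_product_form "\<lambda>a b. T b \<star> bidual_embed a + bidual_embed b \<star> T a"
  proof
    obtain K L where "\<And>a b. norm (T b \<star> bidual_embed a) \<le> norm a * norm b * K"
      "\<And>a b. norm (bidual_embed b \<star> T a) \<le> norm a * norm b * L"
      using l.bounded r.bounded by metis
    then show "\<exists>K. \<forall>a b. norm (T b \<star> bidual_embed a + bidual_embed b \<star> T a) \<le> norm a * norm b * K"
      by (intro exI[of _ "K + L"] allI) (metis add_mono distrib_left norm_triangle_le)
  next
    show "T b \<star> bidual_embed a + bidual_embed b \<star> T a = 0" if "a * b = 0" for a b
      using that anti by (simp add: anti_derivable_at_zero_def)
  qed (simp_all add: l.add_left l.add_right r.add_left r.add_right l.scaleR_left l.scaleR_right
      r.scaleR_left r.scaleR_right scaleR_add_right bidual_embed_scaleC T_scaleC arens_mult_scaleC)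
  show ?thesis using balanced[where a = a and b = b and c = c] .
qed

lemma weak_limit_sandwich:
  assumes "\<And>f. ((\<lambda>i. cdual_apply (m i) f) \<longlongrightarrow> cdual_apply \<xi> f) F"
  shows "((\<lambda>i. cdual_apply (bidual_embed a \<star> m i \<star> bidual_embed b) f) \<longlongrightarrow>
    cdual_apply (bidual_embed a \<star> \<xi> \<star> bidual_embed b) f) F"
  by (simp only: arens_mult.rep_eq[of "_ \<star> _"] embed_arens_apply assms)

text \<open>
  If \<open>A\<close> has a unit, then \<open>\<xi> = T(1)\<close>, and the two identities are the balanced identity with \<open>c = 1\<close>
  and with \<open>a = 1\<close>. In general \<open>\<xi>\<close> is a weak* limit of \<open>T(e)\<close> along an approximate unit. The terms in
  which \<open>e\<close> multiplies an element of the bidual converge after multiplication by some \<open>d \<in> A\<close> from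
  the side of \<open>e\<close>, and \<open>d\<close> is removed by nondegeneracy.
\<close>

lemma exists_unit_value:
  fixes T :: "'a::cstar_algebra \<Rightarrow> 'a bidual"
  assumes T: "bounded_clinear T" and anti: "anti_derivable_at_zero T"
  obtains \<xi> where
    "\<And>a b. T b \<star> bidual_embed a + bidual_embed b \<star> T a = T (a * b) + \<xi> \<star> bidual_embed (a * b)"
    "\<And>a b. T b \<star> bidual_embed a + bidual_embed b \<star> T a = T (a * b) + bidual_embed (a * b) \<star> \<xi>"
proof -
  have lin: "bounded_linear T" using T by (simp add: bounded_clinear_iff)
  obtain K where K: "\<And>x. norm (T x) \<le> norm x * K" "0 < K"
    using bounded_linear.pos_bounded[OF lin] by blast
  obtain F :: "'a filter" where F: "F \<noteq> bot" "eventually (\<lambda>e. norm e \<le> 2) F"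
    "\<And>x. ((\<lambda>e. e * x) \<longlongrightarrow> x) F" "\<And>x. ((\<lambda>e. x * e) \<longlongrightarrow> x) F"
    using approximate_unit_filter by blast
  have "eventually (\<lambda>e. norm (T e) \<le> 2 * K) F"
    using F(2)
  proof eventually_elim
    case (elim e)
    then show ?case using K(1)[of e] mult_right_mono[of "norm e" 2 K] K(2) by linarith
  qed
  then obtain F' \<xi> where F': "F' \<noteq> bot" "F' \<le> F"
    and \<xi>: "\<And>f. ((\<lambda>e. cdual_apply (T e) f) \<longlongrightarrow> cdual_apply \<xi> f) F'"
    using bounded_net_weak_limit[OF F(1)] by metis
  have unit: "((\<lambda>e. e * x) \<longlongrightarrow> x) F'" "((\<lambda>e. x * e) \<longlongrightarrow> x) F'" for x
    using F(3,4) F'(2) tendsto_mono by blast+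
  note lims = arens.tendsto tendsto_add tendsto_const unit bounded_linear.tendsto[OF lin]
    bounded_linear.tendsto[OF bounded_linear_bidual_embed]
  show ?thesis
  proof
    fix a b
    have "bidual_embed d \<star> (T b \<star> bidual_embed a + bidual_embed b \<star> T a -
        T (a * b) - \<xi> \<star> bidual_embed (a * b)) = 0" for d
    proof (rule cdual_eqI)
      fix f
      have eq: "cdual_apply (bidual_embed d \<star> T e \<star> bidual_embed (a * b)) f +
          cdual_apply (bidual_embed (d * e) \<star> T (a * b)) f =
          cdual_apply (bidual_embed d \<star> T (b * e) \<star> bidual_embed a + bidual_embed d \<star> bidual_embed (b * e) \<star> T a) f" for e
        using arg_cong[OF balanced_identity[OF T anti, of e a b], of "\<lambda>\<Psi>. cdual_apply (bidual_embed d \<star> \<Psi>) f"]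
        by (simp add: arens.add_right bidual_embed_mult arens_mult_assoc plus_cdual.rep_eq)
      have "((\<lambda>e. cdual_apply (bidual_embed d \<star> T e \<star> bidual_embed (a * b)) f +
          cdual_apply (bidual_embed (d * e) \<star> T (a * b)) f) \<longlongrightarrow>
          cdual_apply (bidual_embed d \<star> \<xi> \<star> bidual_embed (a * b)) f +
          cdual_apply (bidual_embed d \<star> T (a * b)) f) F'"
        by (intro tendsto_add weak_limit_sandwich \<xi> tendsto_cdual_apply lims)
      moreover have "((\<lambda>e. cdual_apply (bidual_embed d \<star> T (b * e) \<star> bidual_embed a + bidual_embed d \<star> bidual_embed (b * e) \<star> T a) f) \<longlongrightarrow>
          cdual_apply (bidual_embed d \<star> T b \<star> bidual_embed a + bidual_embed d \<star> bidual_embed b \<star> T a) f) F'"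
        by (intro tendsto_cdual_apply lims)
      ultimately have "cdual_apply (bidual_embed d \<star> \<xi> \<star> bidual_embed (a * b)) f +
          cdual_apply (bidual_embed d \<star> T (a * b)) f =
          cdual_apply (bidual_embed d \<star> T b \<star> bidual_embed a + bidual_embed d \<star> bidual_embed b \<star> T a) f"
        unfolding eq by (rule tendsto_unique[OF F'(1)])
      then show "cdual_apply (bidual_embed d \<star> (T b \<star> bidual_embed a + bidual_embed b \<star> T a -
          T (a * b) - \<xi> \<star> bidual_embed (a * b))) f = cdual_apply 0 f"
        by (simp add: arens.add_right arens.diff_right arens_mult_assoc plus_cdual.rep_eq
            minus_cdual.rep_eq zero_cdual.rep_eq diff_eq_eq)
    qed
    from left_nondegenerate[OF this]
    show "T b \<star> bidual_embed a + bidual_embed b \<star> T a = T (a * b) + \<xi> \<star> bidual_embed (a * b)"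
      by (simp add: algebra_simps)
  next
    fix a b
    have "(T b \<star> bidual_embed a + bidual_embed b \<star> T a -
        T (a * b) - bidual_embed (a * b) \<star> \<xi>) \<star> bidual_embed d = 0" for d
    proof (rule cdual_eqI)
      fix f
      have eq: "cdual_apply (T b \<star> bidual_embed (e * a) \<star> bidual_embed d + bidual_embed b \<star> T (e * a) \<star> bidual_embed d) f =
          cdual_apply (T (a * b) \<star> bidual_embed (e * d)) f +
          cdual_apply (bidual_embed (a * b) \<star> T e \<star> bidual_embed d) f" for e
        using arg_cong[OF balanced_identity[OF T anti, of b e a], of "\<lambda>\<Psi>. cdual_apply (\<Psi> \<star> bidual_embed d) f"]
        by (simp add: arens.add_left bidual_embed_mult arens_mult_assoc plus_cdual.rep_eq)
      have "((\<lambda>e. cdual_apply (T (a * b) \<star> bidual_embed (e * d)) f +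
          cdual_apply (bidual_embed (a * b) \<star> T e \<star> bidual_embed d) f) \<longlongrightarrow>
          cdual_apply (T (a * b) \<star> bidual_embed d) f +
          cdual_apply (bidual_embed (a * b) \<star> \<xi> \<star> bidual_embed d) f) F'"
        by (intro tendsto_add weak_limit_sandwich \<xi> tendsto_cdual_apply lims)
      moreover have "((\<lambda>e. cdual_apply (T b \<star> bidual_embed (e * a) \<star> bidual_embed d + bidual_embed b \<star> T (e * a) \<star> bidual_embed d) f) \<longlongrightarrow>
          cdual_apply (T b \<star> bidual_embed a \<star> bidual_embed d + bidual_embed b \<star> T a \<star> bidual_embed d) f) F'"
        by (intro tendsto_cdual_apply lims)
      ultimately have "cdual_apply (T (a * b) \<star> bidual_embed d) f +
          cdual_apply (bidual_embed (a * b) \<star> \<xi> \<star> bidual_embed d) f =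
          cdual_apply (T b \<star> bidual_embed a \<star> bidual_embed d + bidual_embed b \<star> T a \<star> bidual_embed d) f"
        unfolding eq by (rule tendsto_unique[OF F'(1)])
      then show "cdual_apply ((T b \<star> bidual_embed a + bidual_embed b \<star> T a -
          T (a * b) - bidual_embed (a * b) \<star> \<xi>) \<star> bidual_embed d) f = cdual_apply 0 f"
        by (simp add: arens.add_left arens.diff_left plus_cdual.rep_eq minus_cdual.rep_eq
            zero_cdual.rep_eq diff_eq_eq add.commute)
    qed
    from right_nondegenerate[OF this]
    show "T b \<star> bidual_embed a + bidual_embed b \<star> T a = T (a * b) + bidual_embed (a * b) \<star> \<xi>"
      by (simp add: algebra_simps)
  qed
qed

theorem theorem8:
  fixes T :: "'a::cstar_algebra \<Rightarrow> 'a bidual"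
  assumes "bounded_clinear T"
  shows "anti_derivable_at_zero T \<longleftrightarrow>
    (\<exists>\<xi> :: 'a bidual. \<forall>a b.
      \<xi> \<star> bidual_embed a = bidual_embed a \<star> \<xi> \<and>
      \<xi> \<star> bidual_embed (commutator a b) = 0 \<and>
      T a = \<xi> \<star> bidual_embed a)"
proof
  assume "anti_derivable_at_zero T"
  then obtain \<xi> where
    left: "\<And>a b. T b \<star> bidual_embed a + bidual_embed b \<star> T a = T (a * b) + \<xi> \<star> bidual_embed (a * b)" and
    right: "\<And>a b. T b \<star> bidual_embed a + bidual_embed b \<star> T a = T (a * b) + bidual_embed (a * b) \<star> \<xi>"
    using exists_unit_value[OF assms] by blast
  have central: "bidual_embed x \<star> \<xi> = \<xi> \<star> bidual_embed x" for x
  proof -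
    obtain c where c: "(\<lambda>n. x * star x * c n) \<longlonglongrightarrow> x" using in_closure_mult by blast
    have "(\<lambda>n. bidual_embed (x * star x * c n) \<star> \<xi>) \<longlonglongrightarrow> bidual_embed x \<star> \<xi>"
      "(\<lambda>n. \<xi> \<star> bidual_embed (x * star x * c n)) \<longlonglongrightarrow> \<xi> \<star> bidual_embed x"
      by (intro arens.tendsto tendsto_const bounded_linear.tendsto[OF bounded_linear_bidual_embed] c)+
    moreover have "bidual_embed (x * star x * c n) \<star> \<xi> = \<xi> \<star> bidual_embed (x * star x * c n)" for n
      using left[of "c n" "x * star x"] right[of "c n" "x * star x"] by simp
    ultimately show ?thesis using LIMSEQ_unique by simp
  qed
  interpret twisted_anti_derivation "\<lambda>a. T a - \<xi> \<star> bidual_embed a" \<xi>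
  proof (rule twisted_anti_derivation.intro)
    have lin: "bounded_linear T" and T_scaleC: "\<And>c x. T (c *\<^sub>C x) = c *\<^sub>C T x"
      using assms by (auto simp: bounded_clinear_iff)
    show "bounded_linear (\<lambda>a. T a - \<xi> \<star> bidual_embed a)"
      by (intro bounded_linear_sub lin bounded_linear_compose[OF arens.bounded_linear_right]
          bounded_linear_bidual_embed)
    show "T (c *\<^sub>C a) - \<xi> \<star> bidual_embed (c *\<^sub>C a) = c *\<^sub>C (T a - \<xi> \<star> bidual_embed a)" for c a
      by (simp add: T_scaleC bidual_embed_scaleC arens_mult_scaleC scaleC_diff_right)
    show "T (a * b) - \<xi> \<star> bidual_embed (a * b) =
        (T b - \<xi> \<star> bidual_embed b) \<star> bidual_embed a + bidual_embed b \<star> (T a - \<xi> \<star> bidual_embed a) +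
        (\<xi> \<star> bidual_embed (commutator b a) + \<xi> \<star> bidual_embed (commutator b a))" for a b
    proof -
      have T_mult: "T (a * b) = T b \<star> bidual_embed a + bidual_embed b \<star> T a - \<xi> \<star> bidual_embed (a * b)"
        by (simp add: left)
      have "bidual_embed b \<star> (\<xi> \<star> bidual_embed a) = \<xi> \<star> bidual_embed (b * a)"
        by (metis arens_mult_assoc bidual_embed_mult central)
      then show ?thesis
        by (simp add: T_mult commutator_def embed_diff arens.diff_left arens.diff_right
            arens_mult_assoc bidual_embed_mult[symmetric])
    qed
  qed (rule central)
  show "\<exists>\<xi> :: 'a bidual. \<forall>a b. \<xi> \<star> bidual_embed a = bidual_embed a \<star> \<xi> \<and>
      \<xi> \<star> bidual_embed (commutator a b) = 0 \<and> T a = \<xi> \<star> bidual_embed a"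
    using central twist_kills_commutators vanishes by (intro exI[of _ \<xi>]) simp
next
  assume "\<exists>\<xi> :: 'a bidual. \<forall>a b. \<xi> \<star> bidual_embed a = bidual_embed a \<star> \<xi> \<and>
      \<xi> \<star> bidual_embed (commutator a b) = 0 \<and> T a = \<xi> \<star> bidual_embed a"
  then obtain \<xi> where central: "\<And>a. \<xi> \<star> bidual_embed a = bidual_embed a \<star> \<xi>"
    and kills: "\<And>a b. \<xi> \<star> bidual_embed (commutator a b) = 0" and T: "\<And>a. T a = \<xi> \<star> bidual_embed a"
    by blast
  show "anti_derivable_at_zero T"
    unfolding anti_derivable_at_zero_def
  proof (intro allI impI)
    fix a b :: 'a assume "a * b = 0"
    then have "\<xi> \<star> bidual_embed (b * a) = 0"
      using kills[of b a] by (simp add: commutator_def)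
    then show "T b \<star> bidual_embed a + bidual_embed b \<star> T a = 0"
      by (metis T central add.right_neutral arens_mult_assoc bidual_embed_mult)
  qed
qed

end
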